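(* Let $k$ be a field of characteristic zero. For all integers $r\geq 1$ and $d\geq 2$, let $X_{r,d}$ be the affine cone over the image of the $d$th Veronese embedding of $\mathbb{P}^r_k$. Then the sheaf of Kähler differentials $\Omega_{X_{r,d}}$ has cotorsion.
   Context: The $d$th Veronese embedding $v_d\colon\mathbb{P}^r_k\to\mathbb{P}^n_k$, $n=\binom{r+d}{d}-1$, is given by all monomials of degree $d$ in the homogeneous coordinates $x_0,\dots,x_r$. The affine cone over its image is the spectrum of the homogeneous coordinate ring of the image; thus $X_{r,d}\cong\operatorname{Spec} R$, where $R\subset k[x_0,\dots,x_r]$ is the $k$-subalgebra generated by all monomials of degree $d$. (When $k$ contains a primitive $d$th root of unity $\xi$, this is the quotient of $\mathbb{A}^{r+1}_k$ by the cyclic group $\mu_d$ of order $d$ acting through scalar multiplication by powers of $\xi$.) $\Omega_{X_{r,d}}=\Omega_{X_{r,d}/k}$ is the sheaf of Kähler differentials over $k$; it has cotorsion if the natural map $\Omega_{X_{r,d}}\to\Omega_{X_{r,d}}^{\vee\vee}$ to its double dual is not surjective. *)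

theory Defs
  imports "HOL-Algebra.Module" "HOL-Algebra.Ideal" "HOL-Library.Poly_Mapping"
begin

section \<open>Kaehler differentials\<close>

text \<open>
  The fields \<open>mult\<close> and \<open>one\<close> that the record type \<open>module\<close> inherits from \<open>ring\<close> play no
  role in the locale \<open>module\<close>; they are left \<open>undefined\<close> below whenever only a module is meant.
\<close>

definition self_module :: "('a, 'x) ring_scheme \<Rightarrow> ('a, 'a) module" where
  "self_module R = \<lparr>carrier = carrier R, mult = mult R, one = one R, zero = zero R,
     add = add R, smult = mult R\<rparr>"

definition free_module :: "('a, 'x) ring_scheme \<Rightarrow> 'i set \<Rightarrow> ('a, 'i \<Rightarrow> 'a) module" where
  "free_module R I = \<lparr>
     carrier = {f \<in> I \<rightarrow>\<^sub>E carrier R. finite {i \<in> I. f i \<noteq> \<zero>\<^bsub>R\<^esub>}},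
     mult = undefined, one = undefined,
     zero = (\<lambda>i\<in>I. \<zero>\<^bsub>R\<^esub>),
     add = (\<lambda>f g. \<lambda>i\<in>I. f i \<oplus>\<^bsub>R\<^esub> g i),
     smult = (\<lambda>a f. \<lambda>i\<in>I. a \<otimes>\<^bsub>R\<^esub> f i)\<rparr>"

definition free_generator :: "('a, 'x) ring_scheme \<Rightarrow> 'i set \<Rightarrow> 'i \<Rightarrow> 'i \<Rightarrow> 'a" where
  "free_generator R I i = (\<lambda>j\<in>I. if j = i then \<one>\<^bsub>R\<^esub> else \<zero>\<^bsub>R\<^esub>)"

definition submodule_generated ::
    "('a, 'x) ring_scheme \<Rightarrow> ('a, 'm) module \<Rightarrow> 'm set \<Rightarrow> 'm set" where
  "submodule_generated R M A = \<Inter> {N. submodule N R M \<and> A \<subseteq> N}"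

definition quotient_module :: "('a, 'm) module \<Rightarrow> 'm set \<Rightarrow> ('a, 'm set) module" where
  "quotient_module M N = \<lparr>
     carrier = a_rcosets\<^bsub>M\<^esub> N,
     mult = undefined, one = undefined,
     zero = N,
     add = (\<lambda>C D. C <+>\<^bsub>M\<^esub> D),
     smult = (\<lambda>a C. \<Union>x\<in>C. N +>\<^bsub>M\<^esub> (a \<odot>\<^bsub>M\<^esub> x))\<rparr>"

text \<open>
  For a commutative ring \<open>R\<close> and a subring \<open>K\<close> of \<open>R\<close> (given by its carrier), the module of
  relative differentials of \<open>R\<close> over \<open>K\<close>: the generator of the free module at \<open>a\<close> stands for
  the differential of \<open>a\<close>.
\<close>

definition kaehler_relations :: "('a, 'x) ring_scheme \<Rightarrow> 'a set \<Rightarrow> ('a \<Rightarrow> 'a) set" where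
  "kaehler_relations R K =
     (let M = free_module R (carrier R); \<delta> = free_generator R (carrier R) in
       {\<delta> (a \<oplus>\<^bsub>R\<^esub> b) \<ominus>\<^bsub>M\<^esub> (\<delta> a \<oplus>\<^bsub>M\<^esub> \<delta> b) | a b. a \<in> carrier R \<and> b \<in> carrier R} \<union>
       {\<delta> (a \<otimes>\<^bsub>R\<^esub> b) \<ominus>\<^bsub>M\<^esub> (a \<odot>\<^bsub>M\<^esub> \<delta> b \<oplus>\<^bsub>M\<^esub> b \<odot>\<^bsub>M\<^esub> \<delta> a) | a b. a \<in> carrier R \<and> b \<in> carrier R} \<union>
       {\<delta> c | c. c \<in> K})"

definition kaehler_module ::
    "('a, 'x) ring_scheme \<Rightarrow> 'a set \<Rightarrow> ('a, ('a \<Rightarrow> 'a) set) module" where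
  "kaehler_module R K = (let M = free_module R (carrier R) in
     quotient_module M (submodule_generated R M (kaehler_relations R K)))"


section \<open>Sheaves of modules on an affine scheme\<close>

text \<open>A point of the spectrum of \<open>R\<close> is a prime ideal, so sets of points have type \<open>'a set set\<close>.\<close>

definition zariski_opens :: "('a, 'x) ring_scheme \<Rightarrow> 'a set set set" where
  "zariski_opens R = {{P. primeideal P R \<and> \<not> E \<subseteq> P} | E. E \<subseteq> carrier R}"

definition opens_in :: "('a, 'x) ring_scheme \<Rightarrow> 'a set set \<Rightarrow> 'a set set set" where
  "opens_in R U = {V \<in> zariski_opens R. V \<subseteq> U}"

text \<open>
  \<open>fraction R M P m s\<close> is the class of \<open>m/s\<close> in the localization of \<open>M\<close> at the prime \<open>P\<close>.
\<close>

definition fraction :: "('a, 'x) ring_scheme \<Rightarrow> ('a, 'm) module \<Rightarrow> 'a set \<Rightarrow> 'm \<Rightarrow> 'a \<Rightarrow> ('m \<times> 'a) set" where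
  "fraction R M P m s = {(n, t). n \<in> carrier M \<and> t \<in> carrier R - P \<and>
     (\<exists>u \<in> carrier R - P. u \<odot>\<^bsub>M\<^esub> (t \<odot>\<^bsub>M\<^esub> m) = u \<odot>\<^bsub>M\<^esub> (s \<odot>\<^bsub>M\<^esub> n))}"

text \<open>
  In \<open>add\<close> and \<open>localization_smult\<close> the unions run over all representatives of the two
  arguments; all sets in the union coincide.
\<close>

definition localization :: "('a, 'x) ring_scheme \<Rightarrow> ('a, 'm) module \<Rightarrow> 'a set \<Rightarrow> ('m \<times> 'a) set ring" where
  "localization R M P = \<lparr>
     carrier = {fraction R M P m s | m s. m \<in> carrier M \<and> s \<in> carrier R - P},
     mult = undefined, one = undefined,
     zero = fraction R M P \<zero>\<^bsub>M\<^esub> \<one>\<^bsub>R\<^esub>,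
     add = (\<lambda>x y. \<Union>(m, s)\<in>x. \<Union>(n, t)\<in>y.
              fraction R M P (t \<odot>\<^bsub>M\<^esub> m \<oplus>\<^bsub>M\<^esub> s \<odot>\<^bsub>M\<^esub> n) (s \<otimes>\<^bsub>R\<^esub> t))\<rparr>"

definition localization_smult ::
    "('a, 'x) ring_scheme \<Rightarrow> ('a, 'm) module \<Rightarrow> 'a set \<Rightarrow> ('a \<times> 'a) set \<Rightarrow> ('m \<times> 'a) set \<Rightarrow> ('m \<times> 'a) set" where
  "localization_smult R M P x y = (\<Union>(a, s)\<in>x. \<Union>(m, t)\<in>y.
     fraction R M P (a \<odot>\<^bsub>M\<^esub> m) (s \<otimes>\<^bsub>R\<^esub> t))"

text \<open>
  A sheaf of modules over a sheaf of rings whose sections have type \<open>'c\<close>: its modules of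
  sections over the open sets, and for every open set \<open>V\<close> the restriction of sections
  (over an open superset of \<open>V\<close>) to \<open>V\<close>.
\<close>

record ('p, 'c, 's) module_sheaf =
  sections :: "'p set \<Rightarrow> ('c, 's) module"
  res :: "'p set \<Rightarrow> 's \<Rightarrow> 's"

type_synonym ('a, 'm) section_fun = "'a set \<Rightarrow> ('m \<times> 'a) set"

text \<open>The sheaf associated with the \<open>R\<close>-module \<open>M\<close>: sections are locally fractions.\<close>

definition associated_sheaf ::
    "('a, 'x) ring_scheme \<Rightarrow> ('a, 'm) module \<Rightarrow>
     ('a set, ('a, 'a) section_fun, ('a, 'm) section_fun) module_sheaf" where
  "associated_sheaf R M = \<lparr>
     sections = (\<lambda>U. \<lparr>
       carrier = {\<sigma> \<in> (\<Pi>\<^sub>E P\<in>U. carrier (localization R M P)).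
         \<forall>P\<in>U. \<exists>V\<in>opens_in R U. P \<in> V \<and>
           (\<exists>m\<in>carrier M. \<exists>s\<in>carrier R. \<forall>Q\<in>V. s \<notin> Q \<and> \<sigma> Q = fraction R M Q m s)},
       mult = undefined, one = undefined,
       zero = (\<lambda>P\<in>U. \<zero>\<^bsub>localization R M P\<^esub>),
       add = (\<lambda>\<sigma> \<tau>. \<lambda>P\<in>U. \<sigma> P \<oplus>\<^bsub>localization R M P\<^esub> \<tau> P),
       smult = (\<lambda>f \<sigma>. \<lambda>P\<in>U. localization_smult R M P (f P) (\<sigma> P))\<rparr>),
     res = (\<lambda>V \<sigma>. restrict \<sigma> V)\<rparr>"

text \<open>
  The structure sheaf as a module over itself; the product of two sections is \<open>smult\<close>.
\<close>

definition structure_sheaf ::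
    "('a, 'x) ring_scheme \<Rightarrow> ('a set, ('a, 'a) section_fun, ('a, 'a) section_fun) module_sheaf" where
  "structure_sheaf R = associated_sheaf R (self_module R)"

definition kaehler_sheaf ::
    "('a, 'x) ring_scheme \<Rightarrow> 'a set \<Rightarrow>
     ('a set, ('a, 'a) section_fun, ('a, ('a \<Rightarrow> 'a) set) section_fun) module_sheaf" where
  "kaehler_sheaf R K = associated_sheaf R (kaehler_module R K)"

definition linear_maps ::
    "'c set \<Rightarrow> ('c, 'm) module \<Rightarrow> ('c, 'n) module \<Rightarrow> ('m \<Rightarrow> 'n) set" where
  "linear_maps A M N = {f \<in> carrier M \<rightarrow>\<^sub>E carrier N.
     (\<forall>x\<in>carrier M. \<forall>y\<in>carrier M. f (x \<oplus>\<^bsub>M\<^esub> y) = f x \<oplus>\<^bsub>N\<^esub> f y) \<and>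
     (\<forall>a\<in>A. \<forall>x\<in>carrier M. f (a \<odot>\<^bsub>M\<^esub> x) = a \<odot>\<^bsub>N\<^esub> f x)}"

text \<open>
  The dual is the sheaf of homomorphisms into the structure sheaf: a section over \<open>U\<close> is a
  morphism of sheaves of modules between the restrictions to \<open>U\<close>, that is, a family of linear
  maps indexed by the open subsets of \<open>U\<close> that is compatible with restriction of sections.
\<close>

definition dual_sheaf ::
    "('a, 'x) ring_scheme \<Rightarrow> ('a set, ('a, 'a) section_fun, 's) module_sheaf \<Rightarrow>
     ('a set, ('a, 'a) section_fun, 'a set set \<Rightarrow> 's \<Rightarrow> ('a, 'a) section_fun) module_sheaf" where
  "dual_sheaf R F = (let \<O> = structure_sheaf R in \<lparr>
     sections = (\<lambda>U. \<lparr>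
       carrier = {\<phi> \<in> (\<Pi>\<^sub>E V\<in>opens_in R U.
           linear_maps (carrier (sections \<O> V)) (sections F V) (sections \<O> V)).
         \<forall>V\<in>opens_in R U. \<forall>W\<in>opens_in R V. \<forall>\<sigma>\<in>carrier (sections F V).
           \<phi> W (res F W \<sigma>) = res \<O> W (\<phi> V \<sigma>)},
       mult = undefined, one = undefined,
       zero = (\<lambda>V\<in>opens_in R U. \<lambda>\<sigma>\<in>carrier (sections F V). \<zero>\<^bsub>sections \<O> V\<^esub>),
       add = (\<lambda>\<phi> \<psi>. \<lambda>V\<in>opens_in R U. \<lambda>\<sigma>\<in>carrier (sections F V).
                \<phi> V \<sigma> \<oplus>\<^bsub>sections \<O> V\<^esub> \<psi> V \<sigma>),
       smult = (\<lambda>f \<phi>. \<lambda>V\<in>opens_in R U. \<lambda>\<sigma>\<in>carrier (sections F V).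
                  res \<O> V f \<odot>\<^bsub>sections \<O> V\<^esub> \<phi> V \<sigma>)\<rparr>),
     res = (\<lambda>W \<phi>. restrict \<phi> (opens_in R W))\<rparr>)"

definition bidual_map ::
    "('a, 'x) ring_scheme \<Rightarrow> ('a set, ('a, 'a) section_fun, 's) module_sheaf \<Rightarrow> 'a set set \<Rightarrow> 's \<Rightarrow>
     'a set set \<Rightarrow> ('a set set \<Rightarrow> 's \<Rightarrow> ('a, 'a) section_fun) \<Rightarrow> ('a, 'a) section_fun" where
  "bidual_map R F U \<sigma> =
     (\<lambda>V\<in>opens_in R U. \<lambda>\<phi>\<in>carrier (sections (dual_sheaf R F) V). \<phi> V (res F V \<sigma>))"

text \<open>A morphism of sheaves is surjective iff sections of the target lift locally.\<close>

definition sheaf_surjective ::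
    "('a, 'x) ring_scheme \<Rightarrow> ('a set, 'c, 's) module_sheaf \<Rightarrow> ('a set, 'c, 't) module_sheaf \<Rightarrow>
     ('a set set \<Rightarrow> 's \<Rightarrow> 't) \<Rightarrow> bool" where
  "sheaf_surjective R F G f \<longleftrightarrow>
     (\<forall>U\<in>zariski_opens R. \<forall>\<tau>\<in>carrier (sections G U). \<forall>P\<in>U.
        \<exists>V\<in>opens_in R U. P \<in> V \<and> (\<exists>\<sigma>\<in>carrier (sections F V). f V \<sigma> = res G V \<tau>))"

definition has_cotorsion ::
    "('a, 'x) ring_scheme \<Rightarrow> ('a set, ('a, 'a) section_fun, 's) module_sheaf \<Rightarrow> bool" where
  "has_cotorsion R F \<longleftrightarrow>
     \<not> sheaf_surjective R F (dual_sheaf R (dual_sheaf R F)) (bidual_map R F)"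


section \<open>The coordinate ring of the affine cone over a Veronese variety\<close>

text \<open>
  Polynomials in countably many variables indexed by \<open>nat\<close>; \<open>Poly_Mapping.single \<alpha> c\<close> is the
  term with exponent vector \<open>\<alpha>\<close> and coefficient \<open>c\<close>.  Only the variables with index at most
  \<open>r\<close> occur in the subalgebra below.
\<close>

type_synonym 'k polynomials = "(nat \<Rightarrow>\<^sub>0 nat) \<Rightarrow>\<^sub>0 'k"

definition scalar :: "'k::field \<Rightarrow> 'k polynomials" where
  "scalar c = Poly_Mapping.single 0 c"

definition degree_monomials :: "nat \<Rightarrow> nat \<Rightarrow> 'k::field polynomials set" where
  "degree_monomials r d = {Poly_Mapping.single \<alpha> 1 | \<alpha>.
     Poly_Mapping.keys \<alpha> \<subseteq> {..r} \<and> (\<Sum>i\<le>r. Poly_Mapping.lookup \<alpha> i) = d}"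

inductive_set generated_subalgebra :: "'k::field polynomials set \<Rightarrow> 'k polynomials set"
  for G :: "'k polynomials set" where
    generator: "g \<in> G \<Longrightarrow> g \<in> generated_subalgebra G"
  | scalar: "scalar c \<in> generated_subalgebra G"
  | add: "f \<in> generated_subalgebra G \<Longrightarrow> g \<in> generated_subalgebra G \<Longrightarrow> f + g \<in> generated_subalgebra G"
  | mult: "f \<in> generated_subalgebra G \<Longrightarrow> g \<in> generated_subalgebra G \<Longrightarrow> f * g \<in> generated_subalgebra G"

definition veronese_cone_ring :: "nat \<Rightarrow> nat \<Rightarrow> 'k::field polynomials ring" where
  "veronese_cone_ring r d = \<lparr>
     carrier = generated_subalgebra (degree_monomials r d),
     mult = (*), one = 1, zero = 0, add = (+)\<rparr>"

text \<open>
  The sheaf of differentials over \<open>k\<close> of the affine cone, which is the spectrum of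
  \<open>veronese_cone_ring r d\<close>.
\<close>

definition veronese_cone_differentials ::
    "nat \<Rightarrow> nat \<Rightarrow>
     ('k::field polynomials set,
      ('k polynomials, 'k polynomials) section_fun,
      ('k polynomials, ('k polynomials \<Rightarrow> 'k polynomials) set) section_fun) module_sheaf" where
  "veronese_cone_differentials r d = kaehler_sheaf (veronese_cone_ring r d) (range scalar)"

end

theory Submission
  imports "HOL-Computational_Algebra.Fraction_Field" Defs
begin

text \<open>
  Write \<open>x\<^sub>0, x\<^sub>1\<close> for the first two coordinates and \<open>y = x\<^sub>0\<^sup>d\<close>, \<open>z = x\<^sub>0\<^sup>d\<^sup>-\<^sup>1 x\<^sub>1\<close>, \<open>u = x\<^sub>0\<^sup>d\<^sup>-\<^sup>2 x\<^sub>1\<^sup>2\<close>, so that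
  \<open>z\<^sup>2 = y u\<close>.  The form \<open>x\<^sub>0\<^sup>d\<^sup>-\<^sup>1 dx\<^sub>1 = dz - ((d - 1)/d) (z/y) dy\<close> is a section of the bidual that does not
  lift at the vertex.  It is a section because a derivation \<open>D\<close> with values in the local regular
  functions satisfies \<open>2 z Dz = y Du + u Dy\<close>, whence \<open>x\<^sub>0\<close> divides the numerator of \<open>Dy\<close> and \<open>y\<close>
  divides \<open>z Dy\<close>.  It does not lift: pairing the numerator of a lift \<open>\<Sum> f\<^sub>a da / s\<close> at the vertex with the derivations
  \<open>x\<^sub>i \<partial>/\<partial>x\<^sub>i\<close> gives \<open>0\<close> for \<open>i = 0\<close> and \<open>s z\<close> for \<open>i = 1\<close>, while in both cases the coefficient at the
  monomial \<open>z\<close> is the exponent of \<open>x\<^sub>i\<close> in \<open>z\<close> times \<open>\<Sum> f\<^sub>a(0) a\<^sub>z\<close>.  As \<open>d - 1 \<noteq> 0\<close> in the field, this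
  sum vanishes, and so does \<open>s(0)\<close>, although \<open>s\<close> is invertible at the vertex.
\<close>

text \<open>The choice of the form: reflexive differentials of the cone should be the invariant
  forms of affine space. In degree \<open>d\<close> the Kaehler differentials contribute only
  constant combinations of \<open>da\<close> with \<open>a\<close> a monomial of degree
  \<open>d\<close>, hence closed forms, whereas \<open>x\<^sub>0^(d-1) dx\<^sub>1\<close> has
  exterior derivative \<open>(d-1) x\<^sub>0^(d-2) dx\<^sub>0 dx\<^sub>1\<close>. Contraction with
  two Euler derivations detects this failure with functions alone. The obstacle is that a section of
  the dual is a compatible family of maps on sections over all smaller open sets. Neither the dual
  nor the bidual is computed. A section of the dual enters only through its values on the elements
  \<open>da\<close>, which obey the Leibniz rule, and the only dual sections ever constructed come
  from global derivations. As the ring is a domain, all local values are compared in one fixed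
  field. Characteristic zero enters twice: \<open>d\<close> is inverted in the coefficient of
  \<open>dy\<close>, and \<open>d - 1\<close> is cancelled at the end.\<close>

section \<open>Modules of differentials\<close>

text \<open>Module axioms pass along any surjection that respects the operations, so a quotient
  inherits them from \<open>M\<close> without computations on cosets. Nothing is assumed about
  \<open>L\<close> beforehand.\<close>

lemma module_surjective_image:
  fixes M :: "('a, 'm) module" and L :: "('a, 'l) module"
  assumes "module R M"
    and zero: "\<pi> \<zero>\<^bsub>M\<^esub> = \<zero>\<^bsub>L\<^esub>"
    and car: "carrier L = \<pi> ` carrier M"
    and add: "\<And>x y. x \<in> carrier M \<Longrightarrow> y \<in> carrier M \<Longrightarrow> \<pi> (x \<oplus>\<^bsub>M\<^esub> y) = \<pi> x \<oplus>\<^bsub>L\<^esub> \<pi> y"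
    and smult: "\<And>a x. a \<in> carrier R \<Longrightarrow> x \<in> carrier M \<Longrightarrow> \<pi> (a \<odot>\<^bsub>M\<^esub> x) = a \<odot>\<^bsub>L\<^esub> \<pi> x"
  shows "module R L"
proof -
  interpret module R M by fact
  note add' = add[symmetric] and smult' = smult[symmetric]
  have zero_L: "\<zero>\<^bsub>L\<^esub> = \<pi> \<zero>\<^bsub>M\<^esub>"
    by (simp add: zero)
  have "abelian_group L"
  proof (rule abelian_groupI; unfold car)
    fix X Y Z assume "X \<in> \<pi> ` carrier M" "Y \<in> \<pi> ` carrier M" "Z \<in> \<pi> ` carrier M"
    then show "X \<oplus>\<^bsub>L\<^esub> Y \<oplus>\<^bsub>L\<^esub> Z = X \<oplus>\<^bsub>L\<^esub> (Y \<oplus>\<^bsub>L\<^esub> Z)"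
      by (auto simp: add' M.a_assoc)
  next
    fix X Y assume "X \<in> \<pi> ` carrier M" "Y \<in> \<pi> ` carrier M"
    then show "X \<oplus>\<^bsub>L\<^esub> Y \<in> \<pi> ` carrier M" and "X \<oplus>\<^bsub>L\<^esub> Y = Y \<oplus>\<^bsub>L\<^esub> X"
      by (auto simp: add' M.a_comm)
  next
    fix X assume "X \<in> \<pi> ` carrier M"
    then obtain x where x: "x \<in> carrier M" "X = \<pi> x" by auto
    then show "\<zero>\<^bsub>L\<^esub> \<oplus>\<^bsub>L\<^esub> X = X"
      by (simp add: zero_L add')
    show "\<exists>Y\<in>\<pi> ` carrier M. Y \<oplus>\<^bsub>L\<^esub> X = \<zero>\<^bsub>L\<^esub>"
      using x by (intro bexI[of _ "\<pi> (\<ominus>\<^bsub>M\<^esub> x)"]) (auto simp: zero_L add' M.l_neg)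
  qed (auto simp: zero_L)
  then show ?thesis
    by (rule moduleI[OF is_cring])
      (auto simp: car add' smult' smult_l_distr smult_r_distr smult_assoc1)
qed

lemma module_free_module:
  assumes "cring R"
  shows "module R (free_module R I)"
proof -
  interpret cring R by fact
  have ab: "abelian_group (free_module R I)"
  proof (rule abelian_groupI)
    fix f g assume fg: "f \<in> carrier (free_module R I)" "g \<in> carrier (free_module R I)"
    have "{i \<in> I. f i \<oplus>\<^bsub>R\<^esub> g i \<noteq> \<zero>\<^bsub>R\<^esub>} \<subseteq> {i \<in> I. f i \<noteq> \<zero>\<^bsub>R\<^esub>} \<union> {i \<in> I. g i \<noteq> \<zero>\<^bsub>R\<^esub>}"
      by auto
    then have "finite {i \<in> I. f i \<oplus>\<^bsub>R\<^esub> g i \<noteq> \<zero>\<^bsub>R\<^esub>}"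
      using fg by (auto simp: free_module_def elim: finite_subset)
    then show "f \<oplus>\<^bsub>free_module R I\<^esub> g \<in> carrier (free_module R I)"
      using fg by (auto simp: free_module_def PiE_iff cong: conj_cong)
    show "f \<oplus>\<^bsub>free_module R I\<^esub> g = g \<oplus>\<^bsub>free_module R I\<^esub> f"
      using fg by (auto simp: free_module_def PiE_iff intro!: restrict_ext a_comm)
  next
    fix f g h assume "f \<in> carrier (free_module R I)" "g \<in> carrier (free_module R I)"
      "h \<in> carrier (free_module R I)"
    then show "f \<oplus>\<^bsub>free_module R I\<^esub> g \<oplus>\<^bsub>free_module R I\<^esub> h =
        f \<oplus>\<^bsub>free_module R I\<^esub> (g \<oplus>\<^bsub>free_module R I\<^esub> h)"
      by (auto simp: free_module_def PiE_iff a_assoc intro!: restrict_ext)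
  next
    fix f assume f: "f \<in> carrier (free_module R I)"
    then show "\<zero>\<^bsub>free_module R I\<^esub> \<oplus>\<^bsub>free_module R I\<^esub> f = f"
      by (auto simp: free_module_def PiE_iff extensional_def fun_eq_iff)
    have "finite {i \<in> I. \<ominus>\<^bsub>R\<^esub> f i \<noteq> \<zero>\<^bsub>R\<^esub>}"
      using f by (auto simp: free_module_def elim!: finite_subset[rotated])
    then show "\<exists>g\<in>carrier (free_module R I). g \<oplus>\<^bsub>free_module R I\<^esub> f = \<zero>\<^bsub>free_module R I\<^esub>"
      using f by (intro bexI[of _ "\<lambda>i\<in>I. \<ominus>\<^bsub>R\<^esub> f i"])
        (auto simp: free_module_def PiE_iff l_neg cong: conj_cong intro!: restrict_ext)
  qed (auto simp: free_module_def)
  show ?thesis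
  proof (rule moduleI[OF assms ab])
    fix a f assume a: "a \<in> carrier R" and f: "f \<in> carrier (free_module R I)"
    have "{i \<in> I. a \<otimes>\<^bsub>R\<^esub> f i \<noteq> \<zero>\<^bsub>R\<^esub>} \<subseteq> {i \<in> I. f i \<noteq> \<zero>\<^bsub>R\<^esub>}"
      using a by auto
    then have "finite {i \<in> I. a \<otimes>\<^bsub>R\<^esub> f i \<noteq> \<zero>\<^bsub>R\<^esub>}"
      using f by (auto simp: free_module_def elim: finite_subset)
    then show "a \<odot>\<^bsub>free_module R I\<^esub> f \<in> carrier (free_module R I)"
      using a f by (auto simp: free_module_def PiE_iff cong: conj_cong)
  qed (auto simp: free_module_def PiE_iff extensional_def l_distr r_distr m_assoc fun_eq_iff)
qed

lemma free_generator_in_carrier: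
  assumes "cring R"
  shows "free_generator R I i \<in> carrier (free_module R I)"
proof -
  interpret cring R by fact
  have "finite {j \<in> I. (if j = i then \<one>\<^bsub>R\<^esub> else \<zero>\<^bsub>R\<^esub>) \<noteq> \<zero>\<^bsub>R\<^esub>}"
    by (rule finite_subset[of _ "{i}"]) auto
  then show ?thesis
    by (auto simp: free_generator_def free_module_def cong: conj_cong)
qed

text \<open>The inclusion \<open>A \<subseteq> carrier M\<close> makes the carrier a member of the
  intersected family; the intersection of an empty family would be the whole type.\<close>

lemma submodule_submodule_generated:
  assumes "module R M" and "A \<subseteq> carrier M"
  shows "submodule (submodule_generated R M A) R M"
proof -
  interpret module R M by fact
  show ?thesis
  proof (rule submoduleI)
    show "submodule_generated R M A \<subseteq> carrier M"
      using carrier_is_submodule assms(2) by (auto simp: submodule_generated_def)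
    show "\<zero>\<^bsub>M\<^esub> \<in> submodule_generated R M A"
      by (auto simp: submodule_generated_def submodule_def dest: subgroup.one_closed)
  qed (auto simp: submodule_generated_def submoduleE)
qed

lemma generator_in_submodule_generated: "a \<in> A \<Longrightarrow> a \<in> submodule_generated R M A"
  by (auto simp: submodule_generated_def)

lemma submodule_generated_least:
  "submodule N R M \<Longrightarrow> A \<subseteq> N \<Longrightarrow> submodule_generated R M A \<subseteq> N"
  by (auto simp: submodule_generated_def)

section \<open>Quotients by a submodule\<close>

context
  fixes R :: "('a, 'x) ring_scheme" and M :: "('a, 'm) module" and N
  assumes M: "module R M" and N: "submodule N R M"
begin

interpretation module R M by (rule M)

interpretation N: abelian_subgroup N M
  using submodule.axioms(1)[OF N] M.abelian_group_axioms
  by (intro abelian_subgroupI3 additive_subgroup.intro)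

lemma quotient_module_add:
  assumes "x \<in> carrier M" "y \<in> carrier M"
  shows "(N +>\<^bsub>M\<^esub> x) \<oplus>\<^bsub>quotient_module M N\<^esub> (N +>\<^bsub>M\<^esub> y) = N +>\<^bsub>M\<^esub> (x \<oplus>\<^bsub>M\<^esub> y)"
  using assms N.a_rcos_sum by (simp add: quotient_module_def)

lemma quotient_module_smult:
  assumes "a \<in> carrier R" "x \<in> carrier M"
  shows "a \<odot>\<^bsub>quotient_module M N\<^esub> (N +>\<^bsub>M\<^esub> x) = N +>\<^bsub>M\<^esub> (a \<odot>\<^bsub>M\<^esub> x)"
proof -
  \<comment> \<open>The scalar multiple of a coset is a union over all its representatives. Each of
    them contributes the same coset because \<open>N\<close> is closed under scalars.\<close>
  have "N +>\<^bsub>M\<^esub> (a \<odot>\<^bsub>M\<^esub> x') = N +>\<^bsub>M\<^esub> (a \<odot>\<^bsub>M\<^esub> x)" if x': "x' \<in> N +>\<^bsub>M\<^esub> x" for x'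
  proof -
    obtain n where n: "n \<in> N" "x' = n \<oplus>\<^bsub>M\<^esub> x"
      using x' by (auto simp: a_r_coset_def')
    then have "a \<odot>\<^bsub>M\<^esub> x' = a \<odot>\<^bsub>M\<^esub> n \<oplus>\<^bsub>M\<^esub> a \<odot>\<^bsub>M\<^esub> x"
      using assms N.a_subset by (auto simp: smult_r_distr)
    then have "a \<odot>\<^bsub>M\<^esub> x' \<in> N +>\<^bsub>M\<^esub> (a \<odot>\<^bsub>M\<^esub> x)"
      using assms n submodule.smult_closed[OF N] by (auto simp: a_r_coset_def')
    then show ?thesis
      using M.a_repr_independence[OF _ _ submodule.axioms(1)[OF N]] assms by simp
  qed
  moreover have "x \<in> N +>\<^bsub>M\<^esub> x"
    using assms N.a_rcos_self by simp
  ultimately have "(\<Union>x'\<in>N +>\<^bsub>M\<^esub> x. N +>\<^bsub>M\<^esub> (a \<odot>\<^bsub>M\<^esub> x')) = N +>\<^bsub>M\<^esub> (a \<odot>\<^bsub>M\<^esub> x)"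
    by (intro UN_constant_eq ballI)
  then show ?thesis
    by (simp add: quotient_module_def)
qed

lemma quotient_module_carrier: "carrier (quotient_module M N) = (\<lambda>x. N +>\<^bsub>M\<^esub> x) ` carrier M"
  by (auto simp: quotient_module_def A_RCOSETS_def')

lemma quotient_module_zero: "N +>\<^bsub>M\<^esub> \<zero>\<^bsub>M\<^esub> = \<zero>\<^bsub>quotient_module M N\<^esub>"
  using M.a_coset_add_zero[OF N.a_subset] by (simp add: quotient_module_def)

lemma module_quotient_module: "module R (quotient_module M N)"
  by (rule module_surjective_image[OF M, where \<pi> = "\<lambda>x. N +>\<^bsub>M\<^esub> x"])
    (simp_all add: quotient_module_add quotient_module_smult quotient_module_carrier quotient_module_zero)

lemma quotient_module_eqI:
  assumes "x \<in> carrier M" "y \<in> carrier M" "x \<ominus>\<^bsub>M\<^esub> y \<in> N"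
  shows "N +>\<^bsub>M\<^esub> x = N +>\<^bsub>M\<^esub> y"
proof -
  have "x = (x \<ominus>\<^bsub>M\<^esub> y) \<oplus>\<^bsub>M\<^esub> y"
    using assms by (simp add: a_minus_def M.a_assoc M.l_neg)
  then have "x \<in> N +>\<^bsub>M\<^esub> y"
    using assms(3) by (auto simp: a_r_coset_def')
  then show ?thesis
    using assms N.a_repr_independence' by auto
qed

end

text \<open>The universal derivation. Local functionals will be controlled by its Leibniz rule
  \<open>differential_mult\<close>; the additive and constant relations enter in
  \<open>derivation_sum_relations\<close>, where derivations are shown to kill them.\<close>

definition differential :: "('a, 'x) ring_scheme \<Rightarrow> 'a set \<Rightarrow> 'a \<Rightarrow> ('a \<Rightarrow> 'a) set" where
  "differential R K a =
     submodule_generated R (free_module R (carrier R)) (kaehler_relations R K)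
       +>\<^bsub>free_module R (carrier R)\<^esub> free_generator R (carrier R) a"

section \<open>The module of differentials\<close>

context
  fixes R :: "('a, 'x) ring_scheme" and K :: "'a set"
  assumes R: "cring R"
begin

interpretation cring R by (rule R)

private abbreviation (input) "F \<equiv> free_module R (carrier R)"

interpretation F: module R F by (rule module_free_module[OF R])

lemma kaehler_relations_subset: "kaehler_relations R K \<subseteq> carrier F"
proof -
  let ?\<delta> = "free_generator R (carrier R)"
  note \<delta> = free_generator_in_carrier[OF R, of "carrier R"]
  have "?\<delta> (a \<oplus>\<^bsub>R\<^esub> b) \<ominus>\<^bsub>F\<^esub> (?\<delta> a \<oplus>\<^bsub>F\<^esub> ?\<delta> b) \<in> carrier F" for a b
    by (intro F.M.minus_closed F.M.a_closed \<delta>)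
  moreover have "?\<delta> (a \<otimes>\<^bsub>R\<^esub> b) \<ominus>\<^bsub>F\<^esub> (a \<odot>\<^bsub>F\<^esub> ?\<delta> b \<oplus>\<^bsub>F\<^esub> b \<odot>\<^bsub>F\<^esub> ?\<delta> a) \<in> carrier F"
    if "a \<in> carrier R" "b \<in> carrier R" for a b
    using that by (intro F.M.minus_closed F.M.a_closed F.smult_closed \<delta>)
  ultimately show ?thesis
    unfolding kaehler_relations_def Let_def using \<delta> by blast
qed

lemma submodule_kaehler: "submodule (submodule_generated R F (kaehler_relations R K)) R F"
  by (rule submodule_submodule_generated[OF F.module_axioms kaehler_relations_subset])

lemma module_kaehler_module: "module R (kaehler_module R K)"
  unfolding kaehler_module_def Let_def
  by (rule module_quotient_module[OF F.module_axioms submodule_kaehler])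

lemma differential_in_carrier: "differential R K a \<in> carrier (kaehler_module R K)"
  unfolding kaehler_module_def Let_def differential_def
    quotient_module_carrier[OF F.module_axioms submodule_kaehler]
  by (rule imageI[OF free_generator_in_carrier[OF R]])

lemma differential_mult:
  assumes a: "a \<in> carrier R" and b: "b \<in> carrier R"
  shows "differential R K (a \<otimes>\<^bsub>R\<^esub> b) =
    a \<odot>\<^bsub>kaehler_module R K\<^esub> differential R K b \<oplus>\<^bsub>kaehler_module R K\<^esub>
    b \<odot>\<^bsub>kaehler_module R K\<^esub> differential R K a"
proof -
  let ?\<delta> = "free_generator R (carrier R)"
  note \<delta> = free_generator_in_carrier[OF R, of "carrier R"]
  have "?\<delta> (a \<otimes>\<^bsub>R\<^esub> b) \<ominus>\<^bsub>F\<^esub> (a \<odot>\<^bsub>F\<^esub> ?\<delta> b \<oplus>\<^bsub>F\<^esub> b \<odot>\<^bsub>F\<^esub> ?\<delta> a) \<in> kaehler_relations R K"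
    using a b unfolding kaehler_relations_def Let_def by blast
  then have "?\<delta> (a \<otimes>\<^bsub>R\<^esub> b) \<ominus>\<^bsub>F\<^esub> (a \<odot>\<^bsub>F\<^esub> ?\<delta> b \<oplus>\<^bsub>F\<^esub> b \<odot>\<^bsub>F\<^esub> ?\<delta> a)
      \<in> submodule_generated R F (kaehler_relations R K)"
    by (rule generator_in_submodule_generated)
  from quotient_module_eqI[OF F.module_axioms submodule_kaehler \<delta> _ this]
  show ?thesis
    using a b \<delta> by (simp add: differential_def kaehler_module_def Let_def
        quotient_module_add[OF F.module_axioms submodule_kaehler]
        quotient_module_smult[OF F.module_axioms submodule_kaehler])
qed

end

section \<open>Fractions\<close>

text \<open>Sums and products of fractions are defined as unions over all pairs of representatives.
  Such a union is evaluated by exhibiting one pair and showing that every pair gives the same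
  class.\<close>

lemma UN_pairs_constant:
  assumes "(a, b) \<in> A" and "(c, d) \<in> B"
    and "\<And>m s n t. (m, s) \<in> A \<Longrightarrow> (n, t) \<in> B \<Longrightarrow> f m s n t = C"
  shows "(\<Union>(m, s)\<in>A. \<Union>(n, t)\<in>B. f m s n t) = C"
proof -
  have "(\<Union>(n, t)\<in>B. f m s n t) = C" if "(m, s) \<in> A" for m s
    using assms(2,3) that by (intro UN_constant_eq[of "(c, d)"]) auto
  then have "(case p of (m, s) \<Rightarrow> \<Union>(n, t)\<in>B. f m s n t) = C" if "p \<in> A" for p
    using that by (cases p) simp
  then show ?thesis
    using assms(1) by (intro UN_constant_eq[of "(a, b)"] ballI)
qed

context
  fixes R :: "('a, 'x) ring_scheme" (structure) and M :: "('a, 'm) module" and P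
  assumes M: "module R M" and P: "primeideal P R"
begin

interpretation module R M by (rule M)
interpretation primeideal P R by (rule P)

lemma fraction_denominator_one: "\<one> \<in> carrier R - P"
  using I_notcarr one_imp_carrier by auto

lemma fraction_denominator_mult: "s \<in> carrier R - P \<Longrightarrow> t \<in> carrier R - P \<Longrightarrow> s \<otimes> t \<in> carrier R - P"
  using I_prime by auto

lemma mem_fractionI:
  assumes "u \<odot>\<^bsub>M\<^esub> (t \<odot>\<^bsub>M\<^esub> m) = u \<odot>\<^bsub>M\<^esub> (s \<odot>\<^bsub>M\<^esub> n)"
    and "u \<in> carrier R - P" and "n \<in> carrier M" and "t \<in> carrier R - P"
  shows "(n, t) \<in> fraction R M P m s"
  using assms by (auto simp: fraction_def)

lemma mem_fraction_self: "m \<in> carrier M \<Longrightarrow> s \<in> carrier R - P \<Longrightarrow> (m, s) \<in> fraction R M P m s"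
  using fraction_denominator_one by (auto simp: fraction_def)

lemma mem_fraction_trans:
  assumes m: "m \<in> carrier M" "s \<in> carrier R - P"
    and n: "(n, t) \<in> fraction R M P m s" and l: "(l, w) \<in> fraction R M P n t"
  shows "(l, w) \<in> fraction R M P m s"
proof -
  obtain u where u: "u \<in> carrier R - P" "u \<odot>\<^bsub>M\<^esub> (t \<odot>\<^bsub>M\<^esub> m) = u \<odot>\<^bsub>M\<^esub> (s \<odot>\<^bsub>M\<^esub> n)"
    and nt: "n \<in> carrier M" "t \<in> carrier R - P"
    using n by (auto simp: fraction_def)
  obtain v where v: "v \<in> carrier R - P" "v \<odot>\<^bsub>M\<^esub> (w \<odot>\<^bsub>M\<^esub> n) = v \<odot>\<^bsub>M\<^esub> (t \<odot>\<^bsub>M\<^esub> l)"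
    and lw: "l \<in> carrier M" "w \<in> carrier R - P"
    using l by (auto simp: fraction_def)
  \<comment> \<open>The multiplier is \<open>u \<otimes> v \<otimes> t\<close>: besides the two
    given multipliers, the middle denominator \<open>t\<close> has to be absorbed, since it cannot
    be cancelled in \<open>M\<close>.\<close>
  have "(u \<otimes> v \<otimes> t) \<odot>\<^bsub>M\<^esub> (w \<odot>\<^bsub>M\<^esub> m) = (v \<otimes> w) \<odot>\<^bsub>M\<^esub> (u \<odot>\<^bsub>M\<^esub> (t \<odot>\<^bsub>M\<^esub> m))"
    using m nt lw u(1) v(1) by (simp add: smult_assoc1[symmetric] m_ac)
  also have "\<dots> = (u \<otimes> s) \<odot>\<^bsub>M\<^esub> (v \<odot>\<^bsub>M\<^esub> (w \<odot>\<^bsub>M\<^esub> n))"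
    unfolding u(2) using m nt lw u(1) v(1) by (simp add: smult_assoc1[symmetric] m_ac)
  also have "\<dots> = (u \<otimes> v \<otimes> t) \<odot>\<^bsub>M\<^esub> (s \<odot>\<^bsub>M\<^esub> l)"
    unfolding v(2) using m nt lw u(1) v(1) by (simp add: smult_assoc1[symmetric] m_ac)
  finally have "(u \<otimes> v \<otimes> t) \<odot>\<^bsub>M\<^esub> (w \<odot>\<^bsub>M\<^esub> m) = (u \<otimes> v \<otimes> t) \<odot>\<^bsub>M\<^esub> (s \<odot>\<^bsub>M\<^esub> l)" .
  moreover have "u \<otimes> v \<otimes> t \<in> carrier R - P"
    using u(1) v(1) nt(2) by (intro fraction_denominator_mult)
  ultimately show ?thesis
    using lw unfolding fraction_def by blast
qed

lemma mem_fraction_sym: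
  "m \<in> carrier M \<Longrightarrow> s \<in> carrier R - P \<Longrightarrow> (n, t) \<in> fraction R M P m s \<Longrightarrow> (m, s) \<in> fraction R M P n t"
  by (auto simp: fraction_def) (metis DiffI)

text \<open>Symmetry and transitivity reduce equality of classes to one membership, which is what
  the proofs of well-definedness below exhibit.\<close>

lemma fraction_eqI:
  assumes "m \<in> carrier M" "s \<in> carrier R - P" "(n, t) \<in> fraction R M P m s"
  shows "fraction R M P n t = fraction R M P m s"
proof -
  have nt: "n \<in> carrier M" "t \<in> carrier R - P"
    using assms(3) by (auto simp: fraction_def)
  show ?thesis
  proof (intro equalityI subrelI)
    fix l w
    show "(l, w) \<in> fraction R M P n t \<Longrightarrow> (l, w) \<in> fraction R M P m s"
      by (rule mem_fraction_trans[OF assms])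
    show "(l, w) \<in> fraction R M P m s \<Longrightarrow> (l, w) \<in> fraction R M P n t"
      by (rule mem_fraction_trans[OF nt mem_fraction_sym[OF assms]])
  qed
qed

lemma localization_memE:
  assumes "x \<in> carrier (localization R M P)"
  obtains m s where "m \<in> carrier M" "s \<in> carrier R - P" "x = fraction R M P m s"
  using assms by (auto simp: localization_def)

lemma fraction_add:
  assumes m: "m \<in> carrier M" "s \<in> carrier R - P" and n: "n \<in> carrier M" "t \<in> carrier R - P"
  shows "fraction R M P m s \<oplus>\<^bsub>localization R M P\<^esub> fraction R M P n t =
    fraction R M P (t \<odot>\<^bsub>M\<^esub> m \<oplus>\<^bsub>M\<^esub> s \<odot>\<^bsub>M\<^esub> n) (s \<otimes> t)"
proof -
  let ?c = "fraction R M P (t \<odot>\<^bsub>M\<^esub> m \<oplus>\<^bsub>M\<^esub> s \<odot>\<^bsub>M\<^esub> n) (s \<otimes> t)"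
  have eq: "fraction R M P (t' \<odot>\<^bsub>M\<^esub> m' \<oplus>\<^bsub>M\<^esub> s' \<odot>\<^bsub>M\<^esub> n') (s' \<otimes> t') = ?c"
    if m': "(m', s') \<in> fraction R M P m s" and n': "(n', t') \<in> fraction R M P n t" for m' s' n' t'
  proof -
    obtain u where u: "u \<in> carrier R - P" "u \<odot>\<^bsub>M\<^esub> (s' \<odot>\<^bsub>M\<^esub> m) = u \<odot>\<^bsub>M\<^esub> (s \<odot>\<^bsub>M\<^esub> m')"
      and m's': "m' \<in> carrier M" "s' \<in> carrier R - P"
      using m' by (auto simp: fraction_def)
    obtain v where v: "v \<in> carrier R - P" "v \<odot>\<^bsub>M\<^esub> (t' \<odot>\<^bsub>M\<^esub> n) = v \<odot>\<^bsub>M\<^esub> (t \<odot>\<^bsub>M\<^esub> n')"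
      and n't': "n' \<in> carrier M" "t' \<in> carrier R - P"
      using n' by (auto simp: fraction_def)
    note facts = m n m's' n't' u(1) v(1)
    \<comment> \<open>The two summands change representatives one at a time;
      \<open>u \<otimes> v\<close> then serves as multiplier for their sum.\<close>
    have 1: "(u \<otimes> v \<otimes> s' \<otimes> t' \<otimes> t) \<odot>\<^bsub>M\<^esub> m = (u \<otimes> v \<otimes> s \<otimes> t' \<otimes> t) \<odot>\<^bsub>M\<^esub> m'"
    proof -
      have "(u \<otimes> v \<otimes> s' \<otimes> t' \<otimes> t) \<odot>\<^bsub>M\<^esub> m = (v \<otimes> t' \<otimes> t) \<odot>\<^bsub>M\<^esub> (u \<odot>\<^bsub>M\<^esub> (s' \<odot>\<^bsub>M\<^esub> m))"
        using facts by (simp add: smult_assoc1[symmetric] m_ac)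
      then show ?thesis
        unfolding u(2) using facts by (simp add: smult_assoc1[symmetric] m_ac)
    qed
    have 2: "(u \<otimes> v \<otimes> s' \<otimes> t' \<otimes> s) \<odot>\<^bsub>M\<^esub> n = (u \<otimes> v \<otimes> s' \<otimes> s \<otimes> t) \<odot>\<^bsub>M\<^esub> n'"
    proof -
      have "(u \<otimes> v \<otimes> s' \<otimes> t' \<otimes> s) \<odot>\<^bsub>M\<^esub> n = (u \<otimes> s' \<otimes> s) \<odot>\<^bsub>M\<^esub> (v \<odot>\<^bsub>M\<^esub> (t' \<odot>\<^bsub>M\<^esub> n))"
        using facts by (simp add: smult_assoc1[symmetric] m_ac)
      then show ?thesis
        unfolding v(2) using facts by (simp add: smult_assoc1[symmetric] m_ac)
    qed
    have "(u \<otimes> v) \<odot>\<^bsub>M\<^esub> ((s' \<otimes> t') \<odot>\<^bsub>M\<^esub> (t \<odot>\<^bsub>M\<^esub> m \<oplus>\<^bsub>M\<^esub> s \<odot>\<^bsub>M\<^esub> n)) =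
        (u \<otimes> v \<otimes> s' \<otimes> t' \<otimes> t) \<odot>\<^bsub>M\<^esub> m \<oplus>\<^bsub>M\<^esub> (u \<otimes> v \<otimes> s' \<otimes> t' \<otimes> s) \<odot>\<^bsub>M\<^esub> n"
      using facts by (simp add: smult_assoc1[symmetric] smult_r_distr m_ac)
    also have "\<dots> = (u \<otimes> v) \<odot>\<^bsub>M\<^esub> ((s \<otimes> t) \<odot>\<^bsub>M\<^esub> (t' \<odot>\<^bsub>M\<^esub> m' \<oplus>\<^bsub>M\<^esub> s' \<odot>\<^bsub>M\<^esub> n'))"
      unfolding 1 2 using facts by (simp add: smult_assoc1[symmetric] smult_r_distr m_ac)
    finally have "(u \<otimes> v) \<odot>\<^bsub>M\<^esub> ((s' \<otimes> t') \<odot>\<^bsub>M\<^esub> (t \<odot>\<^bsub>M\<^esub> m \<oplus>\<^bsub>M\<^esub> s \<odot>\<^bsub>M\<^esub> n)) =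
        (u \<otimes> v) \<odot>\<^bsub>M\<^esub> ((s \<otimes> t) \<odot>\<^bsub>M\<^esub> (t' \<odot>\<^bsub>M\<^esub> m' \<oplus>\<^bsub>M\<^esub> s' \<odot>\<^bsub>M\<^esub> n'))" .
    then have "(t' \<odot>\<^bsub>M\<^esub> m' \<oplus>\<^bsub>M\<^esub> s' \<odot>\<^bsub>M\<^esub> n', s' \<otimes> t') \<in> ?c"
      by (rule mem_fractionI) (use facts fraction_denominator_mult in simp_all)
    then show ?thesis
      using facts fraction_denominator_mult by (intro fraction_eqI) auto
  qed
  have "(\<Union>(m', s')\<in>fraction R M P m s. \<Union>(n', t')\<in>fraction R M P n t.
      fraction R M P (t' \<odot>\<^bsub>M\<^esub> m' \<oplus>\<^bsub>M\<^esub> s' \<odot>\<^bsub>M\<^esub> n') (s' \<otimes> t')) = ?c"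
    using mem_fraction_self[OF m] mem_fraction_self[OF n] eq by (rule UN_pairs_constant)
  then show ?thesis
    by (simp add: localization_def)
qed

lemma localization_smult_fraction:
  assumes a: "a \<in> carrier R" "s \<in> carrier R - P" and m: "m \<in> carrier M" "t \<in> carrier R - P"
  shows "localization_smult R M P (fraction R (self_module R) P a s) (fraction R M P m t) =
    fraction R M P (a \<odot>\<^bsub>M\<^esub> m) (s \<otimes> t)"
proof -
  let ?c = "fraction R M P (a \<odot>\<^bsub>M\<^esub> m) (s \<otimes> t)"
  have eq: "fraction R M P (a' \<odot>\<^bsub>M\<^esub> m') (s' \<otimes> t') = ?c"
    if a': "(a', s') \<in> fraction R (self_module R) P a s" and m': "(m', t') \<in> fraction R M P m t"
    for a' s' m' t'
  proof -
    obtain u where u: "u \<in> carrier R - P" "u \<otimes> (s' \<otimes> a) = u \<otimes> (s \<otimes> a')"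
      and a's': "a' \<in> carrier R" "s' \<in> carrier R - P"
      using a' by (auto simp: fraction_def self_module_def)
    obtain v where v: "v \<in> carrier R - P" "v \<odot>\<^bsub>M\<^esub> (t' \<odot>\<^bsub>M\<^esub> m) = v \<odot>\<^bsub>M\<^esub> (t \<odot>\<^bsub>M\<^esub> m')"
      and m't': "m' \<in> carrier M" "t' \<in> carrier R - P"
      using m' by (auto simp: fraction_def)
    note facts = a m a's' m't' u(1) v(1)
    have "(u \<otimes> v) \<odot>\<^bsub>M\<^esub> ((s' \<otimes> t') \<odot>\<^bsub>M\<^esub> (a \<odot>\<^bsub>M\<^esub> m)) = (u \<otimes> (s' \<otimes> a)) \<odot>\<^bsub>M\<^esub> (v \<odot>\<^bsub>M\<^esub> (t' \<odot>\<^bsub>M\<^esub> m))"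
      using facts by (simp add: smult_assoc1[symmetric] m_ac)
    also have "\<dots> = (u \<otimes> v) \<odot>\<^bsub>M\<^esub> ((s \<otimes> t) \<odot>\<^bsub>M\<^esub> (a' \<odot>\<^bsub>M\<^esub> m'))"
      unfolding u(2) v(2) using facts by (simp add: smult_assoc1[symmetric] m_ac)
    finally have "(u \<otimes> v) \<odot>\<^bsub>M\<^esub> ((s' \<otimes> t') \<odot>\<^bsub>M\<^esub> (a \<odot>\<^bsub>M\<^esub> m)) =
        (u \<otimes> v) \<odot>\<^bsub>M\<^esub> ((s \<otimes> t) \<odot>\<^bsub>M\<^esub> (a' \<odot>\<^bsub>M\<^esub> m'))" .
    then have "(a' \<odot>\<^bsub>M\<^esub> m', s' \<otimes> t') \<in> ?c"
      by (rule mem_fractionI) (use facts fraction_denominator_mult in simp_all)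
    then show ?thesis
      using facts fraction_denominator_mult by (intro fraction_eqI) auto
  qed
  have "(a, s) \<in> fraction R (self_module R) P a s"
    using a fraction_denominator_one by (auto simp: fraction_def self_module_def)
  then show ?thesis
    unfolding localization_smult_def using mem_fraction_self[OF m] eq by (rule UN_pairs_constant)
qed

end


section \<open>Sections of associated sheaves\<close>

lemma zariski_opens_Int:
  fixes R (structure)
  assumes "cring R" and V: "V \<in> zariski_opens R" and W: "W \<in> zariski_opens R"
  shows "V \<inter> W \<in> zariski_opens R"
proof -
  interpret cring R by fact
  obtain E F where E: "E \<subseteq> carrier R" "V = {P. primeideal P R \<and> \<not> E \<subseteq> P}"
    and F: "F \<subseteq> carrier R" "W = {P. primeideal P R \<and> \<not> F \<subseteq> P}"
    using V W by (auto simp: zariski_opens_def)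
  \<comment> \<open>The complement of an open set is the zero locus of its defining set, and the
    union of two zero loci is cut out by the products. Primality of \<open>P\<close> is used to find
    a factor in \<open>P\<close>.\<close>
  let ?G = "{e \<otimes> f | e f. e \<in> E \<and> f \<in> F}"
  have "\<not> ?G \<subseteq> P \<longleftrightarrow> \<not> E \<subseteq> P \<and> \<not> F \<subseteq> P" if "primeideal P R" for P
  proof -
    interpret primeideal P R by fact
    have "e \<otimes> f \<in> P \<longleftrightarrow> e \<in> P \<or> f \<in> P" if "e \<in> E" "f \<in> F" for e f
    proof -
      have "e \<in> carrier R" "f \<in> carrier R"
        using that E(1) F(1) by auto
      then show ?thesis
        using I_prime[of e f] I_l_closed[of f e] I_r_closed[of e f] by auto
    qed
    then show ?thesis by blast
  qed
  then have "{P. primeideal P R \<and> \<not> ?G \<subseteq> P} = {P. primeideal P R \<and> \<not> E \<subseteq> P \<and> \<not> F \<subseteq> P}"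
    by (intro Collect_cong conj_cong refl)
  moreover have "V \<inter> W = {P. primeideal P R \<and> \<not> E \<subseteq> P \<and> \<not> F \<subseteq> P}"
    unfolding E(2) F(2) by blast
  ultimately have "V \<inter> W = {P. primeideal P R \<and> \<not> ?G \<subseteq> P}"
    by simp
  moreover have "?G \<subseteq> carrier R"
    using E(1) F(1) by auto
  ultimately show ?thesis
    unfolding zariski_opens_def by blast
qed

lemma opens_in_Int:
  "cring R \<Longrightarrow> V \<in> opens_in R U \<Longrightarrow> W \<in> opens_in R U \<Longrightarrow> V \<inter> W \<in> opens_in R U"
  by (auto simp: opens_in_def zariski_opens_Int)

lemma opens_in_trans: "W \<in> opens_in R V \<Longrightarrow> V \<in> opens_in R U \<Longrightarrow> W \<in> opens_in R U"
  by (auto simp: opens_in_def)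

lemma opens_in_self: "V \<in> opens_in R U \<Longrightarrow> V \<in> opens_in R V"
  by (auto simp: opens_in_def)

lemma opens_in_primeideal: "V \<in> opens_in R U \<Longrightarrow> Q \<in> V \<Longrightarrow> primeideal Q R"
  by (auto simp: opens_in_def zariski_opens_def)

lemma module_self_module:
  assumes "cring R"
  shows "module R (self_module R)"
proof -
  interpret cring R by fact
  have "abelian_group (self_module R)"
  proof (rule abelian_groupI)
    fix x assume "x \<in> carrier (self_module R)"
    then show "\<exists>y\<in>carrier (self_module R). y \<oplus>\<^bsub>self_module R\<^esub> x = \<zero>\<^bsub>self_module R\<^esub>"
      by (intro bexI[of _ "\<ominus>\<^bsub>R\<^esub> x"]) (auto simp: self_module_def l_neg)
  qed (auto simp: self_module_def a_assoc intro: a_comm)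
  then show ?thesis
    by (rule moduleI[OF assms]) (auto simp: self_module_def l_distr r_distr m_assoc)
qed

text \<open>The section that an element of \<open>M\<close> defines on every open set. Sections of
  the dual will be probed on these sections, which are compatible with restriction.\<close>

definition element_section ::
    "('a, 'x) ring_scheme \<Rightarrow> ('a, 'm) module \<Rightarrow> 'a set set \<Rightarrow> 'm \<Rightarrow> ('a, 'm) section_fun" where
  "element_section R M V m = (\<lambda>Q\<in>V. fraction R M Q m \<one>\<^bsub>R\<^esub>)"

context
  fixes R :: "('a, 'x) ring_scheme" (structure) and M :: "('a, 'm) module"
  assumes M: "module R M"
begin

interpretation module R M by (rule M)

text \<open>Linear maps between sections are \<open>undefined\<close> outside the carrier, so their
  value at a sum can be unfolded only once the sum is known to be a section. The closure lemmas for
  scalar multiples and restrictions serve the same end. The set \<open>U\<close> is arbitrary: the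
  first assumption says that \<open>V\<close> is open.\<close>

lemma associated_sheaf_add_closed:
  assumes V: "V \<in> opens_in R U"
    and x: "x \<in> carrier (sections (associated_sheaf R M) V)"
    and y: "y \<in> carrier (sections (associated_sheaf R M) V)"
  shows "x \<oplus>\<^bsub>sections (associated_sheaf R M) V\<^esub> y \<in> carrier (sections (associated_sheaf R M) V)"
proof -
  let ?z = "\<lambda>Q\<in>V. x Q \<oplus>\<^bsub>localization R M Q\<^esub> y Q"
  have loc: "\<exists>W\<in>opens_in R V. P \<in> W \<and>
      (\<exists>m\<in>carrier M. \<exists>s\<in>carrier R. \<forall>Q\<in>W. s \<notin> Q \<and> ?z Q = fraction R M Q m s)" if P: "P \<in> V" for P
  proof -
    obtain W1 m s where 1: "W1 \<in> opens_in R V" "P \<in> W1" "m \<in> carrier M" "s \<in> carrier R"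
      "\<forall>Q\<in>W1. s \<notin> Q \<and> x Q = fraction R M Q m s"
      using x P by (auto simp: associated_sheaf_def)
    obtain W2 n t where 2: "W2 \<in> opens_in R V" "P \<in> W2" "n \<in> carrier M" "t \<in> carrier R"
      "\<forall>Q\<in>W2. t \<notin> Q \<and> y Q = fraction R M Q n t"
      using y P by (auto simp: associated_sheaf_def)
    have W: "W1 \<inter> W2 \<in> opens_in R V"
      using 1 2 is_cring by (simp add: opens_in_Int)
    have "s \<otimes> t \<notin> Q \<and> ?z Q = fraction R M Q (t \<odot>\<^bsub>M\<^esub> m \<oplus>\<^bsub>M\<^esub> s \<odot>\<^bsub>M\<^esub> n) (s \<otimes> t)"
      if Q: "Q \<in> W1 \<inter> W2" for Q
    proof -
      have pr: "primeideal Q R"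
        using opens_in_primeideal[OF W Q] .
      have "Q \<in> V" using W Q by (auto simp: opens_in_def)
      then show ?thesis
        using Q 1 2 fraction_add[OF M pr, of m s n t] fraction_denominator_mult[OF M pr, of s t] by auto
    qed
    then show ?thesis
      using 1 2 by (intro bexI[OF _ W] conjI bexI[of _ "t \<odot>\<^bsub>M\<^esub> m \<oplus>\<^bsub>M\<^esub> s \<odot>\<^bsub>M\<^esub> n"] bexI[of _ "s \<otimes> t"]) auto
  qed
  have "?z Q \<in> carrier (localization R M Q)" if "Q \<in> V" for Q
  proof -
    obtain W m s where W: "W \<in> opens_in R V" "Q \<in> W" "m \<in> carrier M" "s \<in> carrier R"
      "\<forall>Q\<in>W. s \<notin> Q \<and> ?z Q = fraction R M Q m s"
      using loc[OF \<open>Q \<in> V\<close>] by blast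
    then show ?thesis by (auto simp: localization_def)
  qed
  with loc have "?z \<in> carrier (sections (associated_sheaf R M) V)"
    by (simp add: associated_sheaf_def)
  then show ?thesis
    by (simp add: associated_sheaf_def)
qed

lemma associated_sheaf_smult_closed:
  assumes V: "V \<in> opens_in R U"
    and f: "f \<in> carrier (sections (structure_sheaf R) V)"
    and y: "y \<in> carrier (sections (associated_sheaf R M) V)"
  shows "f \<odot>\<^bsub>sections (associated_sheaf R M) V\<^esub> y \<in> carrier (sections (associated_sheaf R M) V)"
proof -
  let ?z = "\<lambda>Q\<in>V. localization_smult R M Q (f Q) (y Q)"
  have loc: "\<exists>W\<in>opens_in R V. P \<in> W \<and>
      (\<exists>m\<in>carrier M. \<exists>s\<in>carrier R. \<forall>Q\<in>W. s \<notin> Q \<and> ?z Q = fraction R M Q m s)" if P: "P \<in> V" for P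
  proof -
    obtain W1 a s where 1: "W1 \<in> opens_in R V" "P \<in> W1" "a \<in> carrier R" "s \<in> carrier R"
      "\<forall>Q\<in>W1. s \<notin> Q \<and> f Q = fraction R (self_module R) Q a s"
      using f P by (auto simp: associated_sheaf_def structure_sheaf_def self_module_def)
    obtain W2 n t where 2: "W2 \<in> opens_in R V" "P \<in> W2" "n \<in> carrier M" "t \<in> carrier R"
      "\<forall>Q\<in>W2. t \<notin> Q \<and> y Q = fraction R M Q n t"
      using y P by (auto simp: associated_sheaf_def)
    have W: "W1 \<inter> W2 \<in> opens_in R V"
      using 1 2 is_cring by (simp add: opens_in_Int)
    have "s \<otimes> t \<notin> Q \<and> ?z Q = fraction R M Q (a \<odot>\<^bsub>M\<^esub> n) (s \<otimes> t)"
      if Q: "Q \<in> W1 \<inter> W2" for Q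
    proof -
      have pr: "primeideal Q R"
        using opens_in_primeideal[OF W Q] .
      have "Q \<in> V" using W Q by (auto simp: opens_in_def)
      then show ?thesis
        using Q 1 2 localization_smult_fraction[OF M pr, of a s n t]
          fraction_denominator_mult[OF M pr, of s t] by auto
    qed
    then show ?thesis
      using 1 2 by (intro bexI[OF _ W] conjI bexI[of _ "a \<odot>\<^bsub>M\<^esub> n"] bexI[of _ "s \<otimes> t"]) auto
  qed
  have "?z Q \<in> carrier (localization R M Q)" if "Q \<in> V" for Q
  proof -
    obtain W m s where W: "W \<in> opens_in R V" "Q \<in> W" "m \<in> carrier M" "s \<in> carrier R"
      "\<forall>Q\<in>W. s \<notin> Q \<and> ?z Q = fraction R M Q m s"
      using loc[OF \<open>Q \<in> V\<close>] by blast
    then show ?thesis by (auto simp: localization_def)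
  qed
  with loc have "?z \<in> carrier (sections (associated_sheaf R M) V)"
    by (simp add: associated_sheaf_def)
  then show ?thesis
    by (simp add: associated_sheaf_def)
qed

lemma associated_sheaf_res_closed:
  assumes "W \<in> opens_in R V" and "V \<in> opens_in R U"
    and x: "x \<in> carrier (sections (associated_sheaf R M) V)"
  shows "restrict x W \<in> carrier (sections (associated_sheaf R M) W)"
proof -
  have "\<exists>V'\<in>opens_in R W. P \<in> V' \<and>
      (\<exists>m\<in>carrier M. \<exists>s\<in>carrier R. \<forall>Q\<in>V'. s \<notin> Q \<and> restrict x W Q = fraction R M Q m s)"
    if P: "P \<in> W" for P
  proof -
    have "P \<in> V" using P assms(1) by (auto simp: opens_in_def)
    then obtain W1 m s where 1: "W1 \<in> opens_in R V" "P \<in> W1" "m \<in> carrier M" "s \<in> carrier R"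
      "\<forall>Q\<in>W1. s \<notin> Q \<and> x Q = fraction R M Q m s"
      using x by (auto simp: associated_sheaf_def)
    have "W1 \<inter> W \<in> opens_in R W"
      using 1(1) assms(1) zariski_opens_Int[OF is_cring] by (auto simp: opens_in_def)
    then show ?thesis
      using 1 P by (intro bexI[of _ "W1 \<inter> W"]) auto
  qed
  moreover have "W \<subseteq> V" using assms(1) by (auto simp: opens_in_def)
  ultimately show ?thesis
    using x by (auto simp: associated_sheaf_def)
qed

lemma element_section_in_carrier:
  assumes V: "V \<in> opens_in R U" and m: "m \<in> carrier M"
  shows "element_section R M V m \<in> carrier (sections (associated_sheaf R M) V)"
proof -
  have one: "\<one> \<in> carrier R - Q" if "Q \<in> V" for Q
    using fraction_denominator_one[OF M opens_in_primeideal[OF V that]] .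
  have "\<exists>W\<in>opens_in R V. P \<in> W \<and> (\<exists>n\<in>carrier M. \<exists>s\<in>carrier R. \<forall>Q\<in>W. s \<notin> Q \<and>
      element_section R M V m Q = fraction R M Q n s)" if "P \<in> V" for P
    using that one m opens_in_self[OF V]
    by (intro bexI[of _ V] conjI bexI[of _ m] bexI[of _ \<one>]) (auto simp: element_section_def)
  then show ?thesis
    using one m by (auto simp: associated_sheaf_def element_section_def localization_def)
qed

lemma element_section_add:
  assumes V: "V \<in> opens_in R U" and m: "m \<in> carrier M" and n: "n \<in> carrier M"
  shows "element_section R M V (m \<oplus>\<^bsub>M\<^esub> n) =
    element_section R M V m \<oplus>\<^bsub>sections (associated_sheaf R M) V\<^esub> element_section R M V n"
proof -
  have "fraction R M Q (m \<oplus>\<^bsub>M\<^esub> n) \<one> =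
      fraction R M Q m \<one> \<oplus>\<^bsub>localization R M Q\<^esub> fraction R M Q n \<one>" if "Q \<in> V" for Q
    using fraction_add[OF M opens_in_primeideal[OF V that], of m \<one> n \<one>] m n
      fraction_denominator_one[OF M opens_in_primeideal[OF V that]] by simp
  then show ?thesis
    by (auto simp: associated_sheaf_def element_section_def intro: restrict_ext)
qed

lemma element_section_restrict: "W \<subseteq> V \<Longrightarrow> restrict (element_section R M V m) W = element_section R M W m"
  by (auto simp: element_section_def restrict_def fun_eq_iff)

end


section \<open>Duals and regular functions over a domain\<close>

lemma dual_sheaf_carrier_iff:
  "\<phi> \<in> carrier (sections (dual_sheaf R F) U) \<longleftrightarrow>
    \<phi> \<in> (\<Pi>\<^sub>E V\<in>opens_in R U. linear_maps (carrier (sections (structure_sheaf R) V))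
          (sections F V) (sections (structure_sheaf R) V)) \<and>
    (\<forall>V\<in>opens_in R U. \<forall>W\<in>opens_in R V. \<forall>\<sigma>\<in>carrier (sections F V).
      \<phi> W (res F W \<sigma>) = restrict (\<phi> V \<sigma>) W)"
  by (simp add: dual_sheaf_def Let_def structure_sheaf_def associated_sheaf_def)

lemma dual_sheaf_add:
  "\<phi> \<oplus>\<^bsub>sections (dual_sheaf R F) U\<^esub> \<psi> =
    (\<lambda>V\<in>opens_in R U. \<lambda>\<sigma>\<in>carrier (sections F V). \<phi> V \<sigma> \<oplus>\<^bsub>sections (structure_sheaf R) V\<^esub> \<psi> V \<sigma>)"
  by (simp add: dual_sheaf_def Let_def)

lemma dual_sheaf_smult:
  "f \<odot>\<^bsub>sections (dual_sheaf R F) U\<^esub> \<phi> =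
    (\<lambda>V\<in>opens_in R U. \<lambda>\<sigma>\<in>carrier (sections F V).
      restrict f V \<odot>\<^bsub>sections (structure_sheaf R) V\<^esub> \<phi> V \<sigma>)"
  by (simp add: dual_sheaf_def structure_sheaf_def associated_sheaf_def Let_def)

lemma dual_sheaf_res: "res (dual_sheaf R F) W \<phi> = restrict \<phi> (opens_in R W)"
  by (simp add: dual_sheaf_def Let_def)

lemma dual_sheaf_res_closed:
  assumes "W \<in> opens_in R U" and "\<phi> \<in> carrier (sections (dual_sheaf R F) U)"
  shows "restrict \<phi> (opens_in R W) \<in> carrier (sections (dual_sheaf R F) W)"
proof -
  have "V \<in> opens_in R W \<Longrightarrow> V \<in> opens_in R U" for V
    using assms(1) by (auto simp: opens_in_def)
  moreover have "V' \<in> opens_in R V \<Longrightarrow> V \<in> opens_in R W \<Longrightarrow> V' \<in> opens_in R W" for V V'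
    by (auto simp: opens_in_def)
  ultimately show ?thesis
    using assms(2) unfolding dual_sheaf_carrier_iff by (auto simp: PiE_iff)
qed

lemma dual_sheaf_linear:
  assumes "\<phi> \<in> carrier (sections (dual_sheaf R F) U)" "V \<in> opens_in R U"
  shows "\<phi> V \<in> linear_maps (carrier (sections (structure_sheaf R) V))
          (sections F V) (sections (structure_sheaf R) V)"
  using assms unfolding dual_sheaf_carrier_iff by (auto simp: PiE_iff)

lemma dual_sheaf_compatible:
  assumes "\<phi> \<in> carrier (sections (dual_sheaf R F) U)" "V \<in> opens_in R U" "W \<in> opens_in R V"
    "\<sigma> \<in> carrier (sections F V)"
  shows "\<phi> W (res F W \<sigma>) = restrict (\<phi> V \<sigma>) W"
  using assms unfolding dual_sheaf_carrier_iff by auto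

text \<open>
  The common value in the fraction field of \<open>\<epsilon> m / s\<close> over the representatives of a fraction;
  for \<open>\<epsilon>\<close> the identity it embeds the localizations of a domain into its fraction field.
\<close>

definition functional_value :: "('m \<Rightarrow> 'a::idom) \<Rightarrow> ('m \<times> 'a) set \<Rightarrow> 'a fract" where
  "functional_value \<epsilon> x = (THE v. \<forall>(m, s)\<in>x. v = Fract (\<epsilon> m) s)"

text \<open>The ambient domain will be the full polynomial ring, so \<open>'a fract\<close> may be
  larger than the fraction field of \<open>A\<close>. It still receives every localization of
  \<open>A\<close> at a prime, and equality of fractions becomes cross multiplication in one fixed
  field.\<close>

locale subdomain =
  fixes A :: "'a::idom set" and R :: "'a ring"
  assumes R_eq: "R = \<lparr>carrier = A, mult = (*), one = 1, zero = 0, add = (+)\<rparr>"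
    and one_mem: "1 \<in> A" and add_mem: "a \<in> A \<Longrightarrow> b \<in> A \<Longrightarrow> a + b \<in> A"
    and mult_mem: "a \<in> A \<Longrightarrow> b \<in> A \<Longrightarrow> a * b \<in> A"
    and uminus_mem: "a \<in> A \<Longrightarrow> - a \<in> A"
begin

lemma R_simps [simp]: "carrier R = A" "mult R = (*)" "one R = 1" "zero R = 0" "add R = (+)"
  by (simp_all add: R_eq)

lemma self_module_simps [simp]: "carrier (self_module R) = A" "add (self_module R) = (+)"
    "smult (self_module R) = (*)"
  by (simp_all add: self_module_def)

lemma zero_mem: "0 \<in> A"
  using add_mem[OF one_mem uminus_mem[OF one_mem]] by simp

lemma cring_R: "cring R"
proof (rule cringI)
  show "abelian_group R"
    by (rule abelian_groupI) (auto simp: add_mem zero_mem algebra_simps intro!: bexI[of _ "- _"] uminus_mem)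
  show "comm_monoid R"
    by (rule comm_monoidI) (auto simp: mult_mem one_mem algebra_simps)
qed (auto simp: algebra_simps)

lemma prime_denominator:
  assumes "primeideal Q R" and "s \<in> A - Q"
  shows "s \<noteq> 0"
proof -
  interpret primeideal Q R by fact
  show ?thesis
    using assms(2) additive_subgroup.zero_closed[OF is_additive_subgroup] by auto
qed

lemma prime_mult:
  assumes "primeideal Q R" and "s \<in> A - Q" and "t \<in> A - Q"
  shows "s * t \<in> A - Q"
  using fraction_denominator_mult[OF module_self_module[OF cring_R] assms(1), of s t] assms by simp

lemma prime_one: "primeideal Q R \<Longrightarrow> 1 \<in> A - Q"
  using fraction_denominator_one[OF module_self_module[OF cring_R]] by simp

text \<open>The class in the localization at \<open>Q\<close> that has a given value in the field.
  In a domain the multiplier \<open>u\<close> of \<open>fraction\<close> cancels, so classes and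
  values determine each other; numerators and denominators are still restricted to
  \<open>A\<close>.\<close>

definition germ :: "'a set \<Rightarrow> 'a fract \<Rightarrow> ('a \<times> 'a) set" where
  "germ Q v = {(n, t). n \<in> A \<and> t \<in> A - Q \<and> Fract n t = v}"

lemma fraction_self:
  assumes Q: "primeideal Q R" and m: "m \<in> A" "s \<in> A - Q"
  shows "fraction R (self_module R) Q m s = germ Q (Fract m s)"
proof -
  have "(\<exists>u\<in>A - Q. u * (t * m) = u * (s * n)) \<longleftrightarrow> Fract n t = Fract m s" if "t \<in> A - Q" for n t
    using prime_denominator[OF Q that] prime_denominator[OF Q m(2)] prime_denominator[OF Q]
      prime_one[OF Q] by (auto simp: eq_fract mult.commute intro: bexI[of _ 1])
  then show ?thesis
    by (auto simp: fraction_def germ_def self_module_def)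
qed

lemma functional_value_germ:
  assumes Q: "primeideal Q R" and m: "m \<in> A" "s \<in> A - Q"
  shows "functional_value (\<lambda>a. a) (germ Q (Fract m s)) = Fract m s"
  unfolding functional_value_def
  by (rule the_equality) (use m in \<open>auto simp: germ_def\<close>)

text \<open>A local function is encoded by its field value at each point, so that sheaf operations
  become pointwise arithmetic in the field. Values outside \<open>V\<close> are arbitrary, whence
  the congruence rules below.\<close>

definition regular :: "'a set set \<Rightarrow> ('a set \<Rightarrow> 'a fract) \<Rightarrow> bool" where
  "regular V v \<longleftrightarrow> (\<forall>P\<in>V. \<exists>W\<in>opens_in R V. P \<in> W \<and>
    (\<exists>m\<in>A. \<exists>s\<in>A. \<forall>Q\<in>W. s \<notin> Q \<and> v Q = Fract m s))"

definition function_section :: "'a set set \<Rightarrow> ('a set \<Rightarrow> 'a fract) \<Rightarrow> ('a, 'a) section_fun" where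
  "function_section V v = (\<lambda>Q\<in>V. germ Q (v Q))"

abbreviation "\<O> \<equiv> sections (structure_sheaf R)"

abbreviation value_at :: "('a, 'a) section_fun \<Rightarrow> 'a set \<Rightarrow> 'a fract" where
  "value_at \<sigma> Q \<equiv> functional_value (\<lambda>a. a) (\<sigma> Q)"

lemma regularE:
  assumes "regular V v" and "Q \<in> V" and "V \<in> opens_in R U"
  obtains m s where "m \<in> A" "s \<in> A - Q" "v Q = Fract m s"
  using assms unfolding regular_def by blast

lemma value_at_function_section:
  assumes "regular V v" and "V \<in> opens_in R U" and "Q \<in> V"
  shows "value_at (function_section V v) Q = v Q"
proof -
  obtain m s where "m \<in> A" "s \<in> A - Q" "v Q = Fract m s"
    using assms by (elim regularE)
  then show ?thesis
    using functional_value_germ[OF opens_in_primeideal[OF assms(2,3)], of m s] assms(3)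
    by (simp add: function_section_def)
qed

lemma function_section_cong: "(\<And>Q. Q \<in> V \<Longrightarrow> v Q = w Q) \<Longrightarrow> function_section V v = function_section V w"
  by (simp add: function_section_def cong: restrict_cong)

lemma regular_cong:
  assumes "\<And>Q. Q \<in> V \<Longrightarrow> v Q = w Q"
  shows "regular V v \<longleftrightarrow> regular V w"
proof -
  have "(\<forall>Q\<in>W. s \<notin> Q \<and> v Q = Fract m s) \<longleftrightarrow> (\<forall>Q\<in>W. s \<notin> Q \<and> w Q = Fract m s)"
    if "W \<in> opens_in R V" for W m s
  proof -
    have "v Q = w Q" if "Q \<in> W" for Q
      using that \<open>W \<in> opens_in R V\<close> assms by (auto simp: opens_in_def)
    then show ?thesis by auto
  qed
  then show ?thesis
    unfolding regular_def by (auto cong: bex_cong)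
qed

lemma function_section_in_carrier:
  assumes "regular V v" and V: "V \<in> opens_in R U"
  shows "function_section V v \<in> carrier (\<O> V)"
proof -
  have loc: "\<exists>W\<in>opens_in R V. P \<in> W \<and> (\<exists>m\<in>A. \<exists>s\<in>A. \<forall>Q\<in>W. s \<notin> Q \<and>
      function_section V v Q = fraction R (self_module R) Q m s)" if P: "P \<in> V" for P
  proof -
    obtain W m s where W: "W \<in> opens_in R V" "P \<in> W" "m \<in> A" "s \<in> A"
      and v: "\<forall>Q\<in>W. s \<notin> Q \<and> v Q = Fract m s"
      using assms(1) P unfolding regular_def by blast
    have "s \<notin> Q \<and> function_section V v Q = fraction R (self_module R) Q m s" if Q: "Q \<in> W" for Q
    proof -
      have "Q \<in> V" using Q W by (auto simp: opens_in_def)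
      then show ?thesis
        using v Q W fraction_self[OF opens_in_primeideal[OF W(1) Q], of m s]
        by (simp add: function_section_def)
    qed
    then show ?thesis using W by blast
  qed
  have "function_section V v Q \<in> carrier (localization R (self_module R) Q)" if Q: "Q \<in> V" for Q
  proof -
    obtain W m s where "Q \<in> W" "m \<in> A" "s \<in> A" "\<forall>Q\<in>W. s \<notin> Q \<and>
        function_section V v Q = fraction R (self_module R) Q m s"
      using loc[OF Q] by blast
    then show ?thesis
      by (auto simp: localization_def self_module_def)
  qed
  with loc show ?thesis
    by (simp add: structure_sheaf_def associated_sheaf_def self_module_def function_section_def PiE_iff)
qed

text \<open>Every section of the structure sheaf comes from field values. Identities between
  sections, such as distributivity in the closure lemmas for the dual, are thereby reduced to
  algebra in the fraction field.\<close>

lemma structure_sheafE: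
  assumes \<sigma>: "\<sigma> \<in> carrier (\<O> V)" and V: "V \<in> opens_in R U"
  obtains v where "regular V v" "\<sigma> = function_section V v"
proof
  have loc: "\<exists>W\<in>opens_in R V. P \<in> W \<and> (\<exists>m\<in>A. \<exists>s\<in>A. \<forall>Q\<in>W. s \<notin> Q \<and> \<sigma> Q = germ Q (Fract m s))"
    if P: "P \<in> V" for P
  proof -
    obtain W m s where W: "W \<in> opens_in R V" "P \<in> W" "m \<in> A" "s \<in> A"
      and v: "\<forall>Q\<in>W. s \<notin> Q \<and> \<sigma> Q = fraction R (self_module R) Q m s"
      using \<sigma> P by (auto simp: structure_sheaf_def associated_sheaf_def self_module_def)
    have "\<sigma> Q = germ Q (Fract m s)" if Q: "Q \<in> W" for Q
      using v W Q fraction_self[OF opens_in_primeideal[OF W(1) Q], of m s] by simp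
    then show ?thesis
      using v W by blast
  qed
  show "regular V (value_at \<sigma>)"
    unfolding regular_def
  proof
    fix P assume "P \<in> V"
    then obtain W m s where W: "W \<in> opens_in R V" "P \<in> W" "m \<in> A" "s \<in> A"
      and v: "\<forall>Q\<in>W. s \<notin> Q \<and> \<sigma> Q = germ Q (Fract m s)"
      using loc by blast
    have "value_at \<sigma> Q = Fract m s" if "Q \<in> W" for Q
      using functional_value_germ[OF opens_in_primeideal[OF W(1) that], of m s] W v that by simp
    then show "\<exists>W\<in>opens_in R V. P \<in> W \<and> (\<exists>m\<in>A. \<exists>s\<in>A. \<forall>Q\<in>W. s \<notin> Q \<and> value_at \<sigma> Q = Fract m s)"
      using W v by blast
  qed
  have "\<sigma> Q = germ Q (value_at \<sigma> Q)" if Q: "Q \<in> V" for Q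
  proof -
    obtain W m s where "W \<in> opens_in R V" "Q \<in> W" "m \<in> A" "s \<in> A - Q" "\<sigma> Q = germ Q (Fract m s)"
      using loc[OF Q] by blast
    then show ?thesis
      using functional_value_germ[OF opens_in_primeideal[OF V Q], of m s] by simp
  qed
  moreover have "\<sigma> \<in> extensional V"
    using \<sigma> by (auto simp: structure_sheaf_def associated_sheaf_def PiE_iff)
  ultimately show "\<sigma> = function_section V (value_at \<sigma>)"
    by (auto simp: function_section_def extensional_def fun_eq_iff)
qed

text \<open>Sums and products of fractions can both be written over the product of the denominators,
  and this product stays outside each prime of the smaller neighbourhood. Nonzero denominators are
  granted to \<open>f\<close> because addition of fractions requires them.\<close>

lemma regular_combine:
  assumes v: "regular V v" and w: "regular V w"
    and f: "\<And>m s n t. m \<in> A \<Longrightarrow> s \<in> A - {0} \<Longrightarrow> n \<in> A \<Longrightarrow> t \<in> A - {0} \<Longrightarrow>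
      \<exists>l\<in>A. f (Fract m s) (Fract n t) = Fract l (s * t)"
  shows "regular V (\<lambda>Q. f (v Q) (w Q))"
  unfolding regular_def
proof
  fix P assume P: "P \<in> V"
  obtain W1 m s where 1: "W1 \<in> opens_in R V" "P \<in> W1" "m \<in> A" "s \<in> A"
    "\<forall>Q\<in>W1. s \<notin> Q \<and> v Q = Fract m s"
    using v P unfolding regular_def by blast
  obtain W2 n t where 2: "W2 \<in> opens_in R V" "P \<in> W2" "n \<in> A" "t \<in> A"
    "\<forall>Q\<in>W2. t \<notin> Q \<and> w Q = Fract n t"
    using w P unfolding regular_def by blast
  have W: "W1 \<inter> W2 \<in> opens_in R V"
    using 1 2 cring_R by (simp add: opens_in_Int)
  have "s \<noteq> 0" "t \<noteq> 0"
    using 1 2 prime_denominator[OF opens_in_primeideal[OF 1(1,2)]] by auto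
  then obtain l where l: "l \<in> A" "f (Fract m s) (Fract n t) = Fract l (s * t)"
    using f[of m s n t] 1 2 by auto
  have "s * t \<notin> Q \<and> f (v Q) (w Q) = Fract l (s * t)" if Q: "Q \<in> W1 \<inter> W2" for Q
    using prime_mult[OF opens_in_primeideal[OF W Q], of s t] 1(4,5) 2(4,5) Q l(2) by auto
  moreover have "P \<in> W1 \<inter> W2" "s * t \<in> A"
    using 1 2 by (auto simp: mult_mem)
  ultimately show "\<exists>W\<in>opens_in R V. P \<in> W \<and> (\<exists>m\<in>A. \<exists>s\<in>A. \<forall>Q\<in>W. s \<notin> Q \<and> f (v Q) (w Q) = Fract m s)"
    using W l(1) by (intro bexI[OF _ W] conjI bexI[OF _ l(1)] bexI[of _ "s * t"]) simp_all
qed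

lemma regular_add: "regular V v \<Longrightarrow> regular V w \<Longrightarrow> regular V (\<lambda>Q. v Q + w Q)"
  by (erule regular_combine) (auto intro!: bexI add_mem mult_mem)

lemma regular_mult: "regular V v \<Longrightarrow> regular V w \<Longrightarrow> regular V (\<lambda>Q. v Q * w Q)"
  by (erule regular_combine) (auto intro!: mult_mem)

lemma regular_restrict:
  assumes v: "regular V v" and "W \<in> opens_in R V"
  shows "regular W v"
  unfolding regular_def
proof
  fix P assume P: "P \<in> W"
  then have "P \<in> V" using assms(2) by (auto simp: opens_in_def)
  then obtain W1 m s where 1: "W1 \<in> opens_in R V" "P \<in> W1" "m \<in> A" "s \<in> A"
    "\<forall>Q\<in>W1. s \<notin> Q \<and> v Q = Fract m s"
    using v unfolding regular_def by blast
  have "W1 \<inter> W \<in> opens_in R W"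
    using 1(1) assms(2) zariski_opens_Int[OF cring_R] by (auto simp: opens_in_def)
  then show "\<exists>W'\<in>opens_in R W. P \<in> W' \<and> (\<exists>m\<in>A. \<exists>s\<in>A. \<forall>Q\<in>W'. s \<notin> Q \<and> v Q = Fract m s)"
    using 1 P by (intro bexI[of _ "W1 \<inter> W"]) auto
qed

lemma regular_const: "a \<in> A \<Longrightarrow> V \<in> opens_in R U \<Longrightarrow> regular V (\<lambda>_. Fract a 1)"
  unfolding regular_def using prime_one opens_in_primeideal[of V R U] opens_in_self[of V R U] one_mem
  by blast

lemma function_section_add:
  assumes v: "regular V v" and w: "regular V w" and V: "V \<in> opens_in R U"
  shows "function_section V v \<oplus>\<^bsub>\<O> V\<^esub> function_section V w = function_section V (\<lambda>Q. v Q + w Q)"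
proof -
  have "germ Q (v Q) \<oplus>\<^bsub>localization R (self_module R) Q\<^esub> germ Q (w Q) = germ Q (v Q + w Q)"
    if Q: "Q \<in> V" for Q
  proof -
    obtain m s where m: "m \<in> A" "s \<in> A - Q" "v Q = Fract m s"
      by (rule regularE[OF v Q V])
    obtain n t where n: "n \<in> A" "t \<in> A - Q" "w Q = Fract n t"
      by (rule regularE[OF w Q V])
    have pr: "primeideal Q R" using opens_in_primeideal[OF V Q] .
    have "t * m + s * n \<in> A" "s * t \<in> A - Q"
      using m n prime_mult[OF pr m(2) n(2)] by (auto intro!: add_mem mult_mem)
    then show ?thesis
      using fraction_add[OF module_self_module[OF cring_R] pr, of m s n t] m n
        prime_denominator[OF pr]
      by (simp add: fraction_self[OF pr] algebra_simps)
  qed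
  then show ?thesis
    by (auto simp: function_section_def structure_sheaf_def associated_sheaf_def intro!: restrict_ext)
qed

lemma function_section_smult:
  assumes v: "regular V v" and w: "regular V w" and V: "V \<in> opens_in R U"
  shows "function_section V v \<odot>\<^bsub>\<O> V\<^esub> function_section V w = function_section V (\<lambda>Q. v Q * w Q)"
proof -
  have "localization_smult R (self_module R) Q (germ Q (v Q)) (germ Q (w Q)) = germ Q (v Q * w Q)"
    if Q: "Q \<in> V" for Q
  proof -
    obtain m s where m: "m \<in> A" "s \<in> A - Q" "v Q = Fract m s"
      by (rule regularE[OF v Q V])
    obtain n t where n: "n \<in> A" "t \<in> A - Q" "w Q = Fract n t"
      by (rule regularE[OF w Q V])
    have pr: "primeideal Q R" using opens_in_primeideal[OF V Q] .
    have "m * n \<in> A" "s * t \<in> A - Q"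
      using m n prime_mult[OF pr m(2) n(2)] by (auto intro!: mult_mem)
    then show ?thesis
      using localization_smult_fraction[OF module_self_module[OF cring_R] pr, of m s n t] m n
      by (simp add: fraction_self[OF pr])
  qed
  then show ?thesis
    by (auto simp: function_section_def structure_sheaf_def associated_sheaf_def intro!: restrict_ext)
qed

lemma function_section_restrict:
  "W \<subseteq> V \<Longrightarrow> restrict (function_section V v) W = function_section W v"
  by (auto simp: function_section_def restrict_def fun_eq_iff)

end

lemma res_associated_sheaf [simp]: "res (associated_sheaf R M) W \<sigma> = restrict \<sigma> W"
  by (simp add: associated_sheaf_def)

section \<open>Linear forms as sections of the dual\<close>

locale subdomain_module = subdomain A R for A :: "'a::idom set" and R +
  fixes M :: "('a, 'm) module"
  assumes module_M: "module R M"
begin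

interpretation M: module R M by (rule module_M)

abbreviation "\<M> \<equiv> sections (associated_sheaf R M)"

abbreviation "\<D> \<equiv> sections (dual_sheaf R (associated_sheaf R M))"

abbreviation "functionals \<equiv> linear_maps A M (self_module R)"

lemma functionalsD:
  assumes "\<epsilon> \<in> functionals"
  shows "m \<in> carrier M \<Longrightarrow> \<epsilon> m \<in> A"
    and "m \<in> carrier M \<Longrightarrow> n \<in> carrier M \<Longrightarrow> \<epsilon> (m \<oplus>\<^bsub>M\<^esub> n) = \<epsilon> m + \<epsilon> n"
    and "a \<in> A \<Longrightarrow> m \<in> carrier M \<Longrightarrow> \<epsilon> (a \<odot>\<^bsub>M\<^esub> m) = a * \<epsilon> m"
  using assms by (auto simp: linear_maps_def)

text \<open>\<open>M\<close> may have torsion, but a linear form with values in a domain kills it: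
  after applying \<open>\<epsilon>\<close> the multiplier \<open>u\<close> cancels, so the value
  does not depend on the representative.\<close>

lemma functional_value_fraction:
  assumes \<epsilon>: "\<epsilon> \<in> functionals" and Q: "primeideal Q R" and m: "m \<in> carrier M" "s \<in> A - Q"
  shows "functional_value \<epsilon> (fraction R M Q m s) = Fract (\<epsilon> m) s"
proof -
  have self: "(m, s) \<in> fraction R M Q m s"
    using mem_fraction_self[OF module_M Q, of m s] m by simp
  have eq: "Fract (\<epsilon> n) t = Fract (\<epsilon> m) s" if n: "(n, t) \<in> fraction R M Q m s" for n t
  proof -
    obtain u where u: "u \<in> A - Q" "u \<odot>\<^bsub>M\<^esub> (t \<odot>\<^bsub>M\<^esub> m) = u \<odot>\<^bsub>M\<^esub> (s \<odot>\<^bsub>M\<^esub> n)"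
      and nt: "n \<in> carrier M" "t \<in> A - Q"
      using n by (auto simp: fraction_def)
    have "\<epsilon> (u \<odot>\<^bsub>M\<^esub> (t \<odot>\<^bsub>M\<^esub> m)) = u * (t * \<epsilon> m)" "\<epsilon> (u \<odot>\<^bsub>M\<^esub> (s \<odot>\<^bsub>M\<^esub> n)) = u * (s * \<epsilon> n)"
      using u(1) nt m M.smult_closed functionalsD(3)[OF \<epsilon>] by simp_all
    then have "t * \<epsilon> m = s * \<epsilon> n"
      using u prime_denominator[OF Q u(1)] by simp
    then show ?thesis
      using prime_denominator[OF Q] m nt by (simp add: eq_fract mult.commute)
  qed
  show ?thesis
    unfolding functional_value_def
  proof (rule the_equality)
    show "\<forall>(n, t)\<in>fraction R M Q m s. Fract (\<epsilon> m) s = Fract (\<epsilon> n) t"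
      by (clarify, rule eq[symmetric])
    show "v = Fract (\<epsilon> m) s" if "\<forall>(n, t)\<in>fraction R M Q m s. v = Fract (\<epsilon> n) t" for v
      using bspec[OF that self] by simp
  qed
qed

lemma functional_value_add:
  assumes \<epsilon>: "\<epsilon> \<in> functionals" and Q: "primeideal Q R"
    and x: "x \<in> carrier (localization R M Q)" and y: "y \<in> carrier (localization R M Q)"
  shows "functional_value \<epsilon> (x \<oplus>\<^bsub>localization R M Q\<^esub> y) = functional_value \<epsilon> x + functional_value \<epsilon> y"
proof -
  obtain m s where m: "m \<in> carrier M" "s \<in> A - Q" "x = fraction R M Q m s"
    using localization_memE[OF module_M Q x] by auto
  obtain n t where n: "n \<in> carrier M" "t \<in> A - Q" "y = fraction R M Q n t"
    using localization_memE[OF module_M Q y] by auto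
  have nz: "s \<noteq> 0" "t \<noteq> 0"
    using m n prime_denominator[OF Q] by auto
  have "x \<oplus>\<^bsub>localization R M Q\<^esub> y = fraction R M Q (t \<odot>\<^bsub>M\<^esub> m \<oplus>\<^bsub>M\<^esub> s \<odot>\<^bsub>M\<^esub> n) (s * t)"
    using fraction_add[OF module_M Q, of m s n t] m n by simp
  also have "functional_value \<epsilon> \<dots> = Fract (\<epsilon> (t \<odot>\<^bsub>M\<^esub> m \<oplus>\<^bsub>M\<^esub> s \<odot>\<^bsub>M\<^esub> n)) (s * t)"
    using m n prime_mult[OF Q m(2) n(2)] M.smult_closed by (intro functional_value_fraction[OF \<epsilon> Q]) auto
  also have "\<dots> = Fract (\<epsilon> m) s + Fract (\<epsilon> n) t"
    using m n nz M.smult_closed by (simp add: functionalsD[OF \<epsilon>] algebra_simps)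
  finally show ?thesis
    using m n functional_value_fraction[OF \<epsilon> Q] by simp
qed

lemma functional_value_smult:
  assumes \<epsilon>: "\<epsilon> \<in> functionals" and Q: "primeideal Q R" and a: "a \<in> A" "s \<in> A - Q"
    and y: "y \<in> carrier (localization R M Q)"
  shows "functional_value \<epsilon> (localization_smult R M Q (germ Q (Fract a s)) y) =
    Fract a s * functional_value \<epsilon> y"
proof -
  obtain n t where n: "n \<in> carrier M" "t \<in> A - Q" "y = fraction R M Q n t"
    using localization_memE[OF module_M Q y] by auto
  have "localization_smult R M Q (germ Q (Fract a s)) y = fraction R M Q (a \<odot>\<^bsub>M\<^esub> n) (s * t)"
    using localization_smult_fraction[OF module_M Q, of a s n t] a n fraction_self[OF Q a] by simp
  also have "functional_value \<epsilon> \<dots> = Fract (\<epsilon> (a \<odot>\<^bsub>M\<^esub> n)) (s * t)"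
    using a n prime_mult[OF Q a(2) n(2)] M.smult_closed by (intro functional_value_fraction[OF \<epsilon> Q]) auto
  also have "\<dots> = Fract a s * Fract (\<epsilon> n) t"
    using a n by (simp add: functionalsD[OF \<epsilon>])
  finally show ?thesis
    using n functional_value_fraction[OF \<epsilon> Q] by simp
qed

lemma module_section_at: "\<sigma> \<in> carrier (\<M> V) \<Longrightarrow> Q \<in> V \<Longrightarrow> \<sigma> Q \<in> carrier (localization R M Q)"
  by (auto simp: associated_sheaf_def)

lemma module_sections_add:
  "Q \<in> V \<Longrightarrow> (\<sigma> \<oplus>\<^bsub>\<M> V\<^esub> \<rho>) Q = \<sigma> Q \<oplus>\<^bsub>localization R M Q\<^esub> \<rho> Q"
  by (simp add: associated_sheaf_def)

lemma module_sections_smult: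
  "Q \<in> V \<Longrightarrow> (f \<odot>\<^bsub>\<M> V\<^esub> \<sigma>) Q = localization_smult R M Q (f Q) (\<sigma> Q)"
  by (simp add: associated_sheaf_def)

lemma regular_functional_value:
  assumes \<epsilon>: "\<epsilon> \<in> functionals" and \<sigma>: "\<sigma> \<in> carrier (\<M> V)"
  shows "regular V (\<lambda>Q. functional_value \<epsilon> (\<sigma> Q))"
  unfolding regular_def
proof
  fix P assume "P \<in> V"
  then obtain W m s where W: "W \<in> opens_in R V" "P \<in> W" "m \<in> carrier M" "s \<in> A"
    and eq: "\<forall>Q\<in>W. s \<notin> Q \<and> \<sigma> Q = fraction R M Q m s"
    using \<sigma> by (auto simp: associated_sheaf_def)
  have "functional_value \<epsilon> (\<sigma> Q) = Fract (\<epsilon> m) s" if Q: "Q \<in> W" for Q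
    using functional_value_fraction[OF \<epsilon> opens_in_primeideal[OF W(1) Q], of m s] W eq Q by simp
  then show "\<exists>W\<in>opens_in R V. P \<in> W \<and> (\<exists>m\<in>A. \<exists>s\<in>A. \<forall>Q\<in>W. s \<notin> Q \<and>
      functional_value \<epsilon> (\<sigma> Q) = Fract m s)"
    using W eq functionalsD(1)[OF \<epsilon>] by blast
qed

definition functional_section ::
    "('m \<Rightarrow> 'a) \<Rightarrow> 'a set set \<Rightarrow> 'a set set \<Rightarrow> ('a, 'm) section_fun \<Rightarrow> ('a, 'a) section_fun" where
  "functional_section \<epsilon> U =
    (\<lambda>V\<in>opens_in R U. \<lambda>\<sigma>\<in>carrier (\<M> V). function_section V (\<lambda>Q. functional_value \<epsilon> (\<sigma> Q)))"

text \<open>These sections are the test functionals against which a hypothetical lift will be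
  evaluated.\<close>

lemma functional_section_in_dual:
  assumes \<epsilon>: "\<epsilon> \<in> functionals"
  shows "functional_section \<epsilon> U \<in> carrier (\<D> U)"
  unfolding dual_sheaf_carrier_iff
proof (intro conjI PiE_I ballI)
  fix V assume V: "V \<in> opens_in R U"
  show "functional_section \<epsilon> U V \<in> linear_maps (carrier (\<O> V)) (\<M> V) (\<O> V)"
    unfolding linear_maps_def
  proof (intro CollectI conjI PiE_I ballI)
    fix \<sigma> assume "\<sigma> \<in> carrier (\<M> V)"
    then show "functional_section \<epsilon> U V \<sigma> \<in> carrier (\<O> V)"
      using V regular_functional_value[OF \<epsilon>] by (simp add: functional_section_def function_section_in_carrier)
  next
    fix \<sigma> \<rho> assume \<sigma>: "\<sigma> \<in> carrier (\<M> V)" and \<rho>: "\<rho> \<in> carrier (\<M> V)"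
    have "functional_value \<epsilon> ((\<sigma> \<oplus>\<^bsub>\<M> V\<^esub> \<rho>) Q) = functional_value \<epsilon> (\<sigma> Q) + functional_value \<epsilon> (\<rho> Q)"
      if Q: "Q \<in> V" for Q
      using functional_value_add[OF \<epsilon> opens_in_primeideal[OF V Q] module_section_at[OF \<sigma> Q] module_section_at[OF \<rho> Q]]
      by (simp add: module_sections_add[OF Q])
    then show "functional_section \<epsilon> U V (\<sigma> \<oplus>\<^bsub>\<M> V\<^esub> \<rho>) =
        functional_section \<epsilon> U V \<sigma> \<oplus>\<^bsub>\<O> V\<^esub> functional_section \<epsilon> U V \<rho>"
      using V \<sigma> \<rho> associated_sheaf_add_closed[OF module_M V \<sigma> \<rho>]
        function_section_add[OF regular_functional_value[OF \<epsilon> \<sigma>] regular_functional_value[OF \<epsilon> \<rho>] V]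
      by (simp add: functional_section_def cong: function_section_cong)
  next
    fix f \<sigma> assume f: "f \<in> carrier (\<O> V)" and \<sigma>: "\<sigma> \<in> carrier (\<M> V)"
    obtain v where v: "regular V v" "f = function_section V v"
      by (rule structure_sheafE[OF f V])
    have "functional_value \<epsilon> ((f \<odot>\<^bsub>\<M> V\<^esub> \<sigma>) Q) = v Q * functional_value \<epsilon> (\<sigma> Q)" if Q: "Q \<in> V" for Q
    proof -
      obtain a s where "a \<in> A" "s \<in> A - Q" "v Q = Fract a s"
        by (rule regularE[OF v(1) Q V])
      then show ?thesis
        using functional_value_smult[OF \<epsilon> opens_in_primeideal[OF V Q] _ _ module_section_at[OF \<sigma> Q]] Q v(2)
        by (simp add: module_sections_smult function_section_def)
    qed
    then show "functional_section \<epsilon> U V (f \<odot>\<^bsub>\<M> V\<^esub> \<sigma>) = f \<odot>\<^bsub>\<O> V\<^esub> functional_section \<epsilon> U V \<sigma>"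
      using V \<sigma> associated_sheaf_smult_closed[OF module_M V f \<sigma>]
        function_section_smult[OF v(1) regular_functional_value[OF \<epsilon> \<sigma>] V]
      by (simp add: functional_section_def v(2)[symmetric] cong: function_section_cong)
  qed (use V in \<open>auto simp: functional_section_def\<close>)
next
  fix V W \<sigma> assume V: "V \<in> opens_in R U" and W: "W \<in> opens_in R V" and \<sigma>: "\<sigma> \<in> carrier (\<M> V)"
  have "W \<subseteq> V" using W by (auto simp: opens_in_def)
  then have "functional_section \<epsilon> U V \<sigma> = function_section V (\<lambda>Q. functional_value \<epsilon> (\<sigma> Q))"
    using V \<sigma> by (simp add: functional_section_def)
  moreover have "functional_section \<epsilon> U W (restrict \<sigma> W) = function_section W (\<lambda>Q. functional_value \<epsilon> (\<sigma> Q))"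
    using opens_in_trans[OF W V] associated_sheaf_res_closed[OF module_M W V \<sigma>]
    by (simp add: functional_section_def cong: function_section_cong)
  ultimately show "functional_section \<epsilon> U W (res (associated_sheaf R M) W \<sigma>) =
      restrict (functional_section \<epsilon> U V \<sigma>) W"
    using \<open>W \<subseteq> V\<close> by (simp add: function_section_restrict)
qed (auto simp: functional_section_def)

lemma dual_section_apply:
  assumes \<phi>: "\<phi> \<in> carrier (\<D> U)" and V: "V \<in> opens_in R U" and \<sigma>: "\<sigma> \<in> carrier (\<M> V)"
  obtains v where "regular V v" "\<phi> V \<sigma> = function_section V v"
proof -
  have "\<phi> V \<sigma> \<in> carrier (\<O> V)"
    using dual_sheaf_linear[OF \<phi> V] \<sigma> by (auto simp: linear_maps_def)
  then show ?thesis
    using structure_sheafE[OF _ V] that by blast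
qed

text \<open>A section of the bidual is \<open>undefined\<close> off the carrier of the dual, so its
  additivity can be checked only after the dual is known to be closed under sums;
  \<open>dual_smult_closed\<close> does the same for scalars. In both, the axioms hold because they
  hold for the values in the fraction field.\<close>

lemma dual_add_closed:
  assumes \<phi>: "\<phi> \<in> carrier (\<D> U)" and \<psi>: "\<psi> \<in> carrier (\<D> U)"
  shows "\<phi> \<oplus>\<^bsub>\<D> U\<^esub> \<psi> \<in> carrier (\<D> U)"
  unfolding dual_sheaf_carrier_iff
proof (intro conjI PiE_I ballI)
  let ?\<chi> = "\<phi> \<oplus>\<^bsub>\<D> U\<^esub> \<psi>"
  note \<chi> = dual_sheaf_add[of R "associated_sheaf R M" U \<phi> \<psi>]
  fix V assume V: "V \<in> opens_in R U"
  note lin = dual_sheaf_linear[OF \<phi> V, unfolded linear_maps_def]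
    dual_sheaf_linear[OF \<psi> V, unfolded linear_maps_def]
  show "?\<chi> V \<in> linear_maps (carrier (\<O> V)) (\<M> V) (\<O> V)"
    unfolding linear_maps_def
  proof (intro CollectI conjI PiE_I ballI)
    fix \<sigma> assume \<sigma>: "\<sigma> \<in> carrier (\<M> V)"
    obtain v where v: "regular V v" "\<phi> V \<sigma> = function_section V v"
      by (rule dual_section_apply[OF \<phi> V \<sigma>])
    obtain w where w: "regular V w" "\<psi> V \<sigma> = function_section V w"
      by (rule dual_section_apply[OF \<psi> V \<sigma>])
    show "?\<chi> V \<sigma> \<in> carrier (\<O> V)"
      using V \<sigma> v w regular_add[OF v(1) w(1)] function_section_add[OF v(1) w(1) V]
      by (simp add: \<chi> function_section_in_carrier)
  next
    fix \<sigma> \<rho> assume \<sigma>: "\<sigma> \<in> carrier (\<M> V)" and \<rho>: "\<rho> \<in> carrier (\<M> V)"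
    obtain v where v: "regular V v" "\<phi> V \<sigma> = function_section V v"
      by (rule dual_section_apply[OF \<phi> V \<sigma>])
    obtain w where w: "regular V w" "\<psi> V \<sigma> = function_section V w"
      by (rule dual_section_apply[OF \<psi> V \<sigma>])
    obtain v' where v': "regular V v'" "\<phi> V \<rho> = function_section V v'"
      by (rule dual_section_apply[OF \<phi> V \<rho>])
    obtain w' where w': "regular V w'" "\<psi> V \<rho> = function_section V w'"
      by (rule dual_section_apply[OF \<psi> V \<rho>])
    have "\<phi> V (\<sigma> \<oplus>\<^bsub>\<M> V\<^esub> \<rho>) = \<phi> V \<sigma> \<oplus>\<^bsub>\<O> V\<^esub> \<phi> V \<rho>" "\<psi> V (\<sigma> \<oplus>\<^bsub>\<M> V\<^esub> \<rho>) = \<psi> V \<sigma> \<oplus>\<^bsub>\<O> V\<^esub> \<psi> V \<rho>"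
      using lin \<sigma> \<rho> by auto
    then show "?\<chi> V (\<sigma> \<oplus>\<^bsub>\<M> V\<^esub> \<rho>) = ?\<chi> V \<sigma> \<oplus>\<^bsub>\<O> V\<^esub> ?\<chi> V \<rho>"
      using V \<sigma> \<rho> associated_sheaf_add_closed[OF module_M V \<sigma> \<rho>]
      by (simp add: \<chi> v w v' w' function_section_add[OF _ _ V] regular_add algebra_simps)
  next
    fix f \<sigma> assume f: "f \<in> carrier (\<O> V)" and \<sigma>: "\<sigma> \<in> carrier (\<M> V)"
    obtain u where u: "regular V u" "f = function_section V u"
      by (rule structure_sheafE[OF f V])
    obtain v where v: "regular V v" "\<phi> V \<sigma> = function_section V v"
      by (rule dual_section_apply[OF \<phi> V \<sigma>])
    obtain w where w: "regular V w" "\<psi> V \<sigma> = function_section V w"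
      by (rule dual_section_apply[OF \<psi> V \<sigma>])
    have "\<phi> V (f \<odot>\<^bsub>\<M> V\<^esub> \<sigma>) = f \<odot>\<^bsub>\<O> V\<^esub> \<phi> V \<sigma>" "\<psi> V (f \<odot>\<^bsub>\<M> V\<^esub> \<sigma>) = f \<odot>\<^bsub>\<O> V\<^esub> \<psi> V \<sigma>"
      using lin f \<sigma> by auto
    then show "?\<chi> V (f \<odot>\<^bsub>\<M> V\<^esub> \<sigma>) = f \<odot>\<^bsub>\<O> V\<^esub> ?\<chi> V \<sigma>"
      using V \<sigma> associated_sheaf_smult_closed[OF module_M V f \<sigma>]
      by (simp add: \<chi> u(2) v w u(1) function_section_add[OF _ _ V] function_section_smult[OF _ _ V]
          regular_add regular_mult algebra_simps)
  qed (use V in \<open>auto simp: \<chi>\<close>)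
next
  fix V W \<sigma> assume V: "V \<in> opens_in R U" and W: "W \<in> opens_in R V" and \<sigma>: "\<sigma> \<in> carrier (\<M> V)"
  have "W \<subseteq> V" using W by (auto simp: opens_in_def)
  obtain v where v: "regular V v" "\<phi> V \<sigma> = function_section V v"
    by (rule dual_section_apply[OF \<phi> V \<sigma>])
  obtain w where w: "regular V w" "\<psi> V \<sigma> = function_section V w"
    by (rule dual_section_apply[OF \<psi> V \<sigma>])
  have "\<phi> W (restrict \<sigma> W) = restrict (\<phi> V \<sigma>) W" "\<psi> W (restrict \<sigma> W) = restrict (\<psi> V \<sigma>) W"
    using dual_sheaf_compatible[OF \<phi> V W \<sigma>] dual_sheaf_compatible[OF \<psi> V W \<sigma>] by auto
  then show "(\<phi> \<oplus>\<^bsub>\<D> U\<^esub> \<psi>) W (res (associated_sheaf R M) W \<sigma>) = restrict ((\<phi> \<oplus>\<^bsub>\<D> U\<^esub> \<psi>) V \<sigma>) W"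
    using V \<sigma> \<open>W \<subseteq> V\<close> opens_in_trans[OF W V] associated_sheaf_res_closed[OF module_M W V \<sigma>]
      regular_restrict[OF v(1) W] regular_restrict[OF w(1) W]
    by (simp add: dual_sheaf_add v w function_section_restrict function_section_add[OF _ _ V]
        function_section_add[OF _ _ W])
qed (auto simp: dual_sheaf_add)

lemma dual_smult_closed:
  assumes f: "f \<in> carrier (\<O> U)" and \<phi>: "\<phi> \<in> carrier (\<D> U)" and U: "U \<in> opens_in R X"
  shows "f \<odot>\<^bsub>\<D> U\<^esub> \<phi> \<in> carrier (\<D> U)"
  unfolding dual_sheaf_carrier_iff
proof (intro conjI PiE_I ballI)
  let ?\<chi> = "f \<odot>\<^bsub>\<D> U\<^esub> \<phi>"
  note \<chi> = dual_sheaf_smult[of R "associated_sheaf R M" U f \<phi>]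
  obtain u where u: "regular U u" "f = function_section U u"
    by (rule structure_sheafE[OF f U])
  fix V assume V: "V \<in> opens_in R U"
  have fV: "restrict f V = function_section V u" and uV: "regular V u"
    using V regular_restrict[OF u(1) V] by (auto simp: u(2) opens_in_def function_section_restrict)
  note lin = dual_sheaf_linear[OF \<phi> V, unfolded linear_maps_def]
  show "?\<chi> V \<in> linear_maps (carrier (\<O> V)) (\<M> V) (\<O> V)"
    unfolding linear_maps_def
  proof (intro CollectI conjI PiE_I ballI)
    fix \<sigma> assume \<sigma>: "\<sigma> \<in> carrier (\<M> V)"
    obtain v where v: "regular V v" "\<phi> V \<sigma> = function_section V v"
      by (rule dual_section_apply[OF \<phi> V \<sigma>])
    show "?\<chi> V \<sigma> \<in> carrier (\<O> V)"
      using V \<sigma> v regular_mult[OF uV v(1)] function_section_smult[OF uV v(1) V]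
      by (simp add: \<chi> fV function_section_in_carrier)
  next
    fix \<sigma> \<rho> assume \<sigma>: "\<sigma> \<in> carrier (\<M> V)" and \<rho>: "\<rho> \<in> carrier (\<M> V)"
    obtain v where v: "regular V v" "\<phi> V \<sigma> = function_section V v"
      by (rule dual_section_apply[OF \<phi> V \<sigma>])
    obtain v' where v': "regular V v'" "\<phi> V \<rho> = function_section V v'"
      by (rule dual_section_apply[OF \<phi> V \<rho>])
    have "\<phi> V (\<sigma> \<oplus>\<^bsub>\<M> V\<^esub> \<rho>) = \<phi> V \<sigma> \<oplus>\<^bsub>\<O> V\<^esub> \<phi> V \<rho>"
      using lin \<sigma> \<rho> by auto
    then show "?\<chi> V (\<sigma> \<oplus>\<^bsub>\<M> V\<^esub> \<rho>) = ?\<chi> V \<sigma> \<oplus>\<^bsub>\<O> V\<^esub> ?\<chi> V \<rho>"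
      using V \<sigma> \<rho> associated_sheaf_add_closed[OF module_M V \<sigma> \<rho>] uV
      by (simp add: \<chi> fV v v' function_section_add[OF _ _ V] function_section_smult[OF _ _ V]
          regular_add regular_mult algebra_simps)
  next
    fix g \<sigma> assume g: "g \<in> carrier (\<O> V)" and \<sigma>: "\<sigma> \<in> carrier (\<M> V)"
    obtain w where w: "regular V w" "g = function_section V w"
      by (rule structure_sheafE[OF g V])
    obtain v where v: "regular V v" "\<phi> V \<sigma> = function_section V v"
      by (rule dual_section_apply[OF \<phi> V \<sigma>])
    have "\<phi> V (g \<odot>\<^bsub>\<M> V\<^esub> \<sigma>) = g \<odot>\<^bsub>\<O> V\<^esub> \<phi> V \<sigma>"
      using lin g \<sigma> by auto
    then show "?\<chi> V (g \<odot>\<^bsub>\<M> V\<^esub> \<sigma>) = g \<odot>\<^bsub>\<O> V\<^esub> ?\<chi> V \<sigma>"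
      using V \<sigma> associated_sheaf_smult_closed[OF module_M V g \<sigma>] uV
      by (simp add: \<chi> fV v w(1) w(2) function_section_smult[OF _ _ V] regular_mult algebra_simps)
  qed (use V in \<open>auto simp: \<chi>\<close>)
next
  obtain u where u: "regular U u" "f = function_section U u"
    by (rule structure_sheafE[OF f U])
  fix V W \<sigma> assume V: "V \<in> opens_in R U" and W: "W \<in> opens_in R V" and \<sigma>: "\<sigma> \<in> carrier (\<M> V)"
  have sub: "W \<subseteq> V" "V \<subseteq> U" using W V by (auto simp: opens_in_def)
  obtain v where v: "regular V v" "\<phi> V \<sigma> = function_section V v"
    by (rule dual_section_apply[OF \<phi> V \<sigma>])
  have "\<phi> W (restrict \<sigma> W) = restrict (\<phi> V \<sigma>) W"
    using dual_sheaf_compatible[OF \<phi> V W \<sigma>] by auto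
  moreover have "restrict f V = function_section V u" "restrict f W = function_section W u"
    using sub by (auto simp: u(2) function_section_restrict)
  ultimately show "(f \<odot>\<^bsub>\<D> U\<^esub> \<phi>) W (res (associated_sheaf R M) W \<sigma>) = restrict ((f \<odot>\<^bsub>\<D> U\<^esub> \<phi>) V \<sigma>) W"
    using V \<sigma> sub opens_in_trans[OF W V] associated_sheaf_res_closed[OF module_M W V \<sigma>]
      regular_restrict[OF v(1) W] regular_restrict[OF u(1) V] regular_restrict[OF u(1) opens_in_trans[OF W V]] v(1)
    by (simp add: dual_sheaf_smult v(2) function_section_restrict function_section_smult[OF _ _ V]
        function_section_smult[OF _ _ W])
qed (auto simp: dual_sheaf_smult)

end

section \<open>Sections of the bidual\<close>

context subdomain
begin

text \<open>Applied to the values of a local functional on \<open>dy\<close>, \<open>dz\<close> and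
  \<open>du\<close>: over one denominator, the Leibniz relation becomes a relation between
  numerators in \<open>A\<close>.\<close>

lemma regular_common_denominator:
  assumes "finite I" and "\<And>i. i \<in> I \<Longrightarrow> regular V (v i)" and P: "P \<in> V" and V: "V \<in> opens_in R U"
  shows "\<exists>W\<in>opens_in R V. P \<in> W \<and> (\<exists>s\<in>A. \<exists>m. (\<forall>i\<in>I. m i \<in> A) \<and>
    (\<forall>Q\<in>W. s \<notin> Q \<and> (\<forall>i\<in>I. v i Q = Fract (m i) s)))"
  using assms(1,2)
proof (induction I rule: finite_induct)
  case empty
  have "V \<in> opens_in R V" "\<forall>Q\<in>V. 1 \<notin> Q"
    using opens_in_self[OF V] prime_one opens_in_primeideal[OF V] by auto
  then show ?case using P one_mem by auto
next
  case (insert j I)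
  obtain W1 s m where 1: "W1 \<in> opens_in R V" "P \<in> W1" "s \<in> A" "\<forall>i\<in>I. m i \<in> A"
    "\<forall>Q\<in>W1. s \<notin> Q \<and> (\<forall>i\<in>I. v i Q = Fract (m i) s)"
    using insert.IH insert.prems by (metis insertI2)
  obtain W2 n t where 2: "W2 \<in> opens_in R V" "P \<in> W2" "n \<in> A" "t \<in> A"
    "\<forall>Q\<in>W2. t \<notin> Q \<and> v j Q = Fract n t"
    using insert.prems[of j] P unfolding regular_def by blast
  have W: "W1 \<inter> W2 \<in> opens_in R V"
    using 1 2 cring_R by (simp add: opens_in_Int)
  let ?m = "\<lambda>i. if i = j then n * s else m i * t"
  have "s * t \<notin> Q \<and> (\<forall>i\<in>insert j I. v i Q = Fract (?m i) (s * t))" if Q: "Q \<in> W1 \<inter> W2" for Q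
  proof -
    have st: "s \<in> A - Q" "t \<in> A - Q" using Q 1 2 by auto
    have pr: "primeideal Q R" using opens_in_primeideal[OF W Q] .
    have nz: "s \<noteq> 0" "t \<noteq> 0"
      using st prime_denominator[OF pr] by auto
    then have "v i Q = Fract (?m i) (s * t)" if "i \<in> insert j I" for i
      using that 1(5) 2(5) Q insert.hyps(2) by (auto simp: eq_fract)
    then show ?thesis
      using prime_mult[OF pr st] by auto
  qed
  moreover have "\<forall>i\<in>insert j I. ?m i \<in> A"
    using 1 2 by (auto simp: mult_mem)
  ultimately show ?case
    using 1(2,3) 2(2,4) mult_mem[of s t]
    by (intro bexI[OF _ W] conjI bexI[of _ "s * t"] exI[of _ ?m]) simp_all
qed

end

section \<open>Evaluating dual sections on elements of the module\<close>

context subdomain_module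
begin

interpretation M: module R M by (rule module_M)

text \<open>Sections of the dual are linear over \<open>\<O> V\<close>, so a scalar \<open>a\<close>
  must first be turned into the section \<open>a / 1\<close>.\<close>

lemma element_section_smult:
  assumes V: "V \<in> opens_in R U" and a: "a \<in> A" and m: "m \<in> carrier M"
  shows "element_section R M V (a \<odot>\<^bsub>M\<^esub> m) =
    function_section V (\<lambda>_. Fract a 1) \<odot>\<^bsub>\<M> V\<^esub> element_section R M V m"
proof -
  have "fraction R M Q (a \<odot>\<^bsub>M\<^esub> m) 1 =
      localization_smult R M Q (germ Q (Fract a 1)) (fraction R M Q m 1)" if "Q \<in> V" for Q
  proof -
    have pr: "primeideal Q R" using opens_in_primeideal[OF V that] .
    show ?thesis
      using localization_smult_fraction[OF module_M pr, of a 1 m 1] a m prime_one[OF pr]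
        fraction_self[OF pr a] by simp
  qed
  then show ?thesis
    by (auto simp: associated_sheaf_def element_section_def function_section_def intro: restrict_ext)
qed

text \<open>For \<open>m = da\<close> in the module of differentials this is \<open>D a\<close>,
  where \<open>D\<close> is the derivation with values in local functions that corresponds to
  \<open>\<phi>\<close>.\<close>

definition pairing :: "'a set set \<Rightarrow> ('a set set \<Rightarrow> ('a, 'm) section_fun \<Rightarrow> ('a, 'a) section_fun) \<Rightarrow>
    'm \<Rightarrow> 'a set \<Rightarrow> 'a fract" where
  "pairing V \<phi> m = value_at (\<phi> V (element_section R M V m))"

context
  fixes U V \<phi>
  assumes V: "V \<in> opens_in R U" and \<phi>: "\<phi> \<in> carrier (\<D> V)"
begin

lemma pairing_section:
  assumes "m \<in> carrier M"
  shows "regular V (pairing V \<phi> m)"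
    and "\<phi> V (element_section R M V m) = function_section V (pairing V \<phi> m)"
proof -
  obtain v where v: "regular V v" "\<phi> V (element_section R M V m) = function_section V v"
    by (rule dual_section_apply[OF \<phi> opens_in_self[OF V] element_section_in_carrier[OF module_M V assms]])
  have *: "pairing V \<phi> m Q = v Q" if "Q \<in> V" for Q
    unfolding pairing_def v(2) by (rule value_at_function_section[OF v(1) V that])
  show "regular V (pairing V \<phi> m)"
    using v(1) regular_cong[of V "pairing V \<phi> m" v] * by simp
  show "\<phi> V (element_section R M V m) = function_section V (pairing V \<phi> m)"
    unfolding v(2) by (rule function_section_cong) (simp add: *)
qed

lemma pairing_vector_add:
  assumes m: "m \<in> carrier M" and n: "n \<in> carrier M" and Q: "Q \<in> V"
  shows "pairing V \<phi> (m \<oplus>\<^bsub>M\<^esub> n) Q = pairing V \<phi> m Q + pairing V \<phi> n Q"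
proof -
  note sec = element_section_in_carrier[OF module_M V]
  have "\<phi> V (element_section R M V (m \<oplus>\<^bsub>M\<^esub> n)) =
      \<phi> V (element_section R M V m) \<oplus>\<^bsub>\<O> V\<^esub> \<phi> V (element_section R M V n)"
    using dual_sheaf_linear[OF \<phi> opens_in_self[OF V]] sec[OF m] sec[OF n]
    by (simp add: element_section_add[OF module_M V m n] linear_maps_def)
  then show ?thesis
    using function_section_add[OF pairing_section(1)[OF m] pairing_section(1)[OF n] V]
      value_at_function_section[OF regular_add[OF pairing_section(1)[OF m] pairing_section(1)[OF n]] V Q]
    unfolding pairing_section(2)[OF m] pairing_section(2)[OF n] by (simp add: pairing_def)
qed

lemma pairing_vector_smult:
  assumes a: "a \<in> A" and m: "m \<in> carrier M" and Q: "Q \<in> V"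
  shows "pairing V \<phi> (a \<odot>\<^bsub>M\<^esub> m) Q = Fract a 1 * pairing V \<phi> m Q"
proof -
  note sec = element_section_in_carrier[OF module_M V]
  note ra = regular_const[OF a V]
  have "\<phi> V (element_section R M V (a \<odot>\<^bsub>M\<^esub> m)) =
      function_section V (\<lambda>_. Fract a 1) \<odot>\<^bsub>\<O> V\<^esub> \<phi> V (element_section R M V m)"
    using dual_sheaf_linear[OF \<phi> opens_in_self[OF V]] sec[OF m] function_section_in_carrier[OF ra V]
    by (simp add: element_section_smult[OF V a m] linear_maps_def)
  then show ?thesis
    using function_section_smult[OF ra pairing_section(1)[OF m] V]
      value_at_function_section[OF regular_mult[OF ra pairing_section(1)[OF m]] V Q]
    unfolding pairing_section(2)[OF m] by (simp add: pairing_def)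
qed

lemma pairing_restrict:
  assumes W: "W \<in> opens_in R V" and m: "m \<in> carrier M" and Q: "Q \<in> W"
  shows "pairing W (restrict \<phi> (opens_in R W)) m Q = pairing V \<phi> m Q"
proof -
  have "W \<subseteq> V" using W by (auto simp: opens_in_def)
  moreover have "\<phi> W (element_section R M W m) = restrict (\<phi> V (element_section R M V m)) W"
    using dual_sheaf_compatible[OF \<phi> opens_in_self[OF V] W element_section_in_carrier[OF module_M V m]]
    by (simp add: element_section_restrict[OF module_M \<open>W \<subseteq> V\<close>])
  ultimately show ?thesis
    using Q opens_in_self[OF W] by (simp add: pairing_def)
qed

end

lemma pairing_add:
  assumes V: "V \<in> opens_in R U" and \<phi>: "\<phi> \<in> carrier (\<D> V)" and \<psi>: "\<psi> \<in> carrier (\<D> V)"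
    and m: "m \<in> carrier M" and Q: "Q \<in> V"
  shows "pairing V (\<phi> \<oplus>\<^bsub>\<D> V\<^esub> \<psi>) m Q = pairing V \<phi> m Q + pairing V \<psi> m Q"
proof -
  have "(\<phi> \<oplus>\<^bsub>\<D> V\<^esub> \<psi>) V (element_section R M V m) =
      function_section V (\<lambda>Q. pairing V \<phi> m Q + pairing V \<psi> m Q)"
    using assms opens_in_self[OF V] element_section_in_carrier[OF module_M V m]
    by (simp add: dual_sheaf_add pairing_section function_section_add[OF _ _ V])
  then show ?thesis
    using value_at_function_section[OF regular_add[OF pairing_section(1)[OF V \<phi> m] pairing_section(1)[OF V \<psi> m]] V Q]
    by (simp add: pairing_def)
qed

lemma pairing_smult:
  assumes V: "V \<in> opens_in R U" and \<phi>: "\<phi> \<in> carrier (\<D> V)"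
    and u: "regular V u" and m: "m \<in> carrier M" and Q: "Q \<in> V"
  shows "pairing V (function_section V u \<odot>\<^bsub>\<D> V\<^esub> \<phi>) m Q = u Q * pairing V \<phi> m Q"
proof -
  have "(function_section V u \<odot>\<^bsub>\<D> V\<^esub> \<phi>) V (element_section R M V m) =
      function_section V (\<lambda>Q. u Q * pairing V \<phi> m Q)"
    using assms opens_in_self[OF V] element_section_in_carrier[OF module_M V m]
    by (simp add: dual_sheaf_smult pairing_section function_section_smult[OF _ _ V] function_section_restrict)
  then show ?thesis
    using value_at_function_section[OF regular_mult[OF u pairing_section(1)[OF V \<phi> m]] V Q]
    by (simp add: pairing_def)
qed

lemma pairing_functional_section:
  assumes \<epsilon>: "\<epsilon> \<in> functionals" and V: "V \<in> opens_in R U" and m: "m \<in> carrier M" and Q: "Q \<in> V"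
  shows "pairing V (functional_section \<epsilon> V) m Q = Fract (\<epsilon> m) 1"
proof -
  have pr: "primeideal Q R" using opens_in_primeideal[OF V Q] .
  note sec = element_section_in_carrier[OF module_M V m]
  have "pairing V (functional_section \<epsilon> V) m Q = functional_value \<epsilon> (element_section R M V m Q)"
    using value_at_function_section[OF regular_functional_value[OF \<epsilon> sec] V Q] sec opens_in_self[OF V]
    by (simp add: pairing_def functional_section_def)
  then show ?thesis
    using functional_value_fraction[OF \<epsilon> pr m, of 1] prime_one[OF pr] Q by (simp add: element_section_def)
qed

text \<open>
  The section of the bidual given by the element \<open>z - c y\<close> of \<open>M\<close> tensored with the fraction
  field, provided that all sections of the dual take regular values on it.
\<close>

definition bidual_section :: "'m \<Rightarrow> 'a fract \<Rightarrow> 'm \<Rightarrow> 'a set set \<Rightarrow> 'a set set \<Rightarrow>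
    ('a set set \<Rightarrow> ('a, 'm) section_fun \<Rightarrow> ('a, 'a) section_fun) \<Rightarrow> ('a, 'a) section_fun" where
  "bidual_section z c y U = (\<lambda>V\<in>opens_in R U. \<lambda>\<phi>\<in>carrier (\<D> V).
    function_section V (\<lambda>Q. pairing V \<phi> z Q - c * pairing V \<phi> y Q))"

text \<open>The pairing is linear in \<open>\<phi>\<close> and compatible with restriction, and
  these properties survive multiplication by any constant \<open>c\<close> of the field. Regularity
  of the values is the one condition left, and it is where the geometry of the cone enters.\<close>

lemma bidual_section_in_bidual:
  assumes z: "z \<in> carrier M" and y: "y \<in> carrier M"
    and reg: "\<And>V \<phi>. V \<in> opens_in R U \<Longrightarrow> \<phi> \<in> carrier (\<D> V) \<Longrightarrow>
      regular V (\<lambda>Q. pairing V \<phi> z Q - c * pairing V \<phi> y Q)"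
  shows "bidual_section z c y U \<in>
    carrier (sections (dual_sheaf R (dual_sheaf R (associated_sheaf R M))) U)"
  unfolding dual_sheaf_carrier_iff
proof (intro conjI PiE_I ballI)
  fix V assume V: "V \<in> opens_in R U"
  show "bidual_section z c y U V \<in> linear_maps (carrier (\<O> V)) (\<D> V) (\<O> V)"
    unfolding linear_maps_def
  proof (intro CollectI conjI PiE_I ballI)
    fix \<phi> assume "\<phi> \<in> carrier (\<D> V)"
    then show "bidual_section z c y U V \<phi> \<in> carrier (\<O> V)"
      using V reg by (simp add: bidual_section_def function_section_in_carrier)
  next
    fix \<phi> \<psi> assume \<phi>: "\<phi> \<in> carrier (\<D> V)" and \<psi>: "\<psi> \<in> carrier (\<D> V)"
    have "pairing V (\<phi> \<oplus>\<^bsub>\<D> V\<^esub> \<psi>) z Q - c * pairing V (\<phi> \<oplus>\<^bsub>\<D> V\<^esub> \<psi>) y Q =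
        (pairing V \<phi> z Q - c * pairing V \<phi> y Q) + (pairing V \<psi> z Q - c * pairing V \<psi> y Q)"
      if Q: "Q \<in> V" for Q
      using pairing_add[OF V \<phi> \<psi> z Q]
        pairing_add[OF V \<phi> \<psi> y Q] by (simp add: algebra_simps)
    then show "bidual_section z c y U V (\<phi> \<oplus>\<^bsub>\<D> V\<^esub> \<psi>) =
        bidual_section z c y U V \<phi> \<oplus>\<^bsub>\<O> V\<^esub> bidual_section z c y U V \<psi>"
      using V \<phi> \<psi> dual_add_closed[OF \<phi> \<psi>] function_section_add[OF reg[OF V \<phi>] reg[OF V \<psi>] V]
      by (simp add: bidual_section_def cong: function_section_cong)
  next
    fix f \<phi> assume f: "f \<in> carrier (\<O> V)" and \<phi>: "\<phi> \<in> carrier (\<D> V)"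
    obtain u where u: "regular V u" "f = function_section V u"
      by (rule structure_sheafE[OF f V])
    have "pairing V (f \<odot>\<^bsub>\<D> V\<^esub> \<phi>) z Q - c * pairing V (f \<odot>\<^bsub>\<D> V\<^esub> \<phi>) y Q =
        u Q * (pairing V \<phi> z Q - c * pairing V \<phi> y Q)" if Q: "Q \<in> V" for Q
      using pairing_smult[OF V \<phi> u(1) z Q] pairing_smult[OF V \<phi> u(1) y Q]
      by (simp add: u(2) algebra_simps)
    then show "bidual_section z c y U V (f \<odot>\<^bsub>\<D> V\<^esub> \<phi>) = f \<odot>\<^bsub>\<O> V\<^esub> bidual_section z c y U V \<phi>"
      using V \<phi> dual_smult_closed[OF f \<phi> V] function_section_smult[OF u(1) reg[OF V \<phi>] V]
      by (simp add: bidual_section_def u(2)[symmetric] cong: function_section_cong)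
  qed (use V in \<open>auto simp: bidual_section_def\<close>)
next
  fix V W \<phi> assume V: "V \<in> opens_in R U" and W: "W \<in> opens_in R V" and \<phi>: "\<phi> \<in> carrier (\<D> V)"
  have "W \<subseteq> V" using W by (auto simp: opens_in_def)
  then show "bidual_section z c y U W (res (dual_sheaf R (associated_sheaf R M)) W \<phi>) =
      restrict (bidual_section z c y U V \<phi>) W"
    using V \<phi> opens_in_trans[OF W V] dual_sheaf_res_closed[OF W \<phi>]
      pairing_restrict[OF V \<phi> W z] pairing_restrict[OF V \<phi> W y]
    by (simp add: bidual_section_def dual_sheaf_res function_section_restrict cong: function_section_cong)
qed (auto simp: bidual_section_def)

text \<open>Only the stalk \<open>w / s\<close> of the lift at \<open>Q\<close> is kept. Evaluating
  the lift and the bidual section on the dual section of a global linear form turns the lifting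
  equation into an equation in the fraction field, one for each form.\<close>

lemma bidual_section_lift_value:
  assumes V: "V \<in> opens_in R U" and Q: "Q \<in> V"
    and z: "z \<in> carrier M" and y: "y \<in> carrier M"
    and reg: "\<And>V \<phi>. V \<in> opens_in R U \<Longrightarrow> \<phi> \<in> carrier (\<D> V) \<Longrightarrow>
      regular V (\<lambda>Q. pairing V \<phi> z Q - c * pairing V \<phi> y Q)"
    and \<sigma>: "\<sigma> \<in> carrier (\<M> V)"
    and eq: "bidual_map R (associated_sheaf R M) V \<sigma> = restrict (bidual_section z c y U) (opens_in R V)"
  obtains w s where "w \<in> carrier M" "s \<in> A - Q"
    and "\<And>\<epsilon>. \<epsilon> \<in> functionals \<Longrightarrow> Fract (\<epsilon> w) s = Fract (\<epsilon> z) 1 - c * Fract (\<epsilon> y) 1"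
proof -
  have pr: "primeideal Q R" using opens_in_primeideal[OF V Q] .
  obtain w s where w: "w \<in> carrier M" "s \<in> A - Q" "\<sigma> Q = fraction R M Q w s"
    using localization_memE[OF module_M pr module_section_at[OF \<sigma> Q]] by auto
  have "Fract (\<epsilon> w) s = Fract (\<epsilon> z) 1 - c * Fract (\<epsilon> y) 1" if \<epsilon>: "\<epsilon> \<in> functionals" for \<epsilon>
  proof -
    let ?\<phi> = "functional_section \<epsilon> V"
    have \<phi>: "?\<phi> \<in> carrier (\<D> V)" by (rule functional_section_in_dual[OF \<epsilon>])
    \<comment> \<open>\<open>bidual_map\<close> evaluates at the restriction of
      \<open>\<sigma>\<close> to \<open>V\<close>; sections are extensional, so this is
      \<open>\<sigma>\<close> again.\<close>
    have "restrict \<sigma> V = \<sigma>"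
      using \<sigma> by (intro extensional_restrict) (auto simp: associated_sheaf_def PiE_iff)
    then have "?\<phi> V \<sigma> = bidual_section z c y U V ?\<phi>"
      using fun_cong[OF fun_cong[OF eq], of V ?\<phi>] opens_in_self[OF V] \<phi> by (simp add: bidual_map_def)
    then have "function_section V (\<lambda>Q. functional_value \<epsilon> (\<sigma> Q)) =
        function_section V (\<lambda>Q. pairing V ?\<phi> z Q - c * pairing V ?\<phi> y Q)"
      using V opens_in_self[OF V] \<phi> \<sigma> by (simp add: bidual_section_def functional_section_def)
    then have "functional_value \<epsilon> (\<sigma> Q) = pairing V ?\<phi> z Q - c * pairing V ?\<phi> y Q"
      using value_at_function_section[OF regular_functional_value[OF \<epsilon> \<sigma>] V Q]
        value_at_function_section[OF reg[OF V \<phi>] V Q] by simp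
    then show ?thesis
      using functional_value_fraction[OF \<epsilon> pr w(1,2)] w(3)
      by (simp add: pairing_functional_section[OF \<epsilon> V z Q] pairing_functional_section[OF \<epsilon> V y Q])
  qed
  then show ?thesis using that w by blast
qed

end

section \<open>Extending a derivation linearly to the free module\<close>

context subdomain
begin

text \<open>The linear extension of \<open>\<delta> a |-> E a\<close> to the free module, that is,
  the contraction of the symbol \<open>\<Sum> f a da\<close> with \<open>E\<close>.\<close>

definition derivation_sum :: "('a \<Rightarrow> 'a) \<Rightarrow> ('a \<Rightarrow> 'a) \<Rightarrow> 'a" where
  "derivation_sum E f = (\<Sum>a\<in>{a \<in> A. f a \<noteq> 0}. f a * E a)"

abbreviation "free \<equiv> free_module R A"

lemma module_free: "module R free"
  by (rule module_free_module[OF cring_R])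

lemma free_carrierD:
  assumes "f \<in> carrier free"
  shows "a \<in> A \<Longrightarrow> f a \<in> A" and "finite {a \<in> A. f a \<noteq> 0}"
  using assms by (auto simp: free_module_def)

text \<open>The supports of \<open>f\<close>, \<open>g\<close> and their sum differ; this allows one
  finite index set for all three.\<close>

lemma derivation_sum_superset:
  assumes "finite S" "{a \<in> A. f a \<noteq> 0} \<subseteq> S" "S \<subseteq> A"
  shows "derivation_sum E f = (\<Sum>a\<in>S. f a * E a)"
  unfolding derivation_sum_def using assms by (intro sum.mono_neutral_left) auto

lemma derivation_sum_add:
  assumes f: "f \<in> carrier free" and g: "g \<in> carrier free"
  shows "derivation_sum E (f \<oplus>\<^bsub>free\<^esub> g) = derivation_sum E f + derivation_sum E g"
proof -
  let ?S = "{a \<in> A. f a \<noteq> 0} \<union> {a \<in> A. g a \<noteq> 0}"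
  have S: "finite ?S"
    using f g free_carrierD(2) by auto
  have "derivation_sum E (f \<oplus>\<^bsub>free\<^esub> g) = (\<Sum>a\<in>?S. (f \<oplus>\<^bsub>free\<^esub> g) a * E a)"
    using S by (rule derivation_sum_superset) (auto simp: free_module_def)
  also have "\<dots> = (\<Sum>a\<in>?S. f a * E a + g a * E a)"
    by (rule sum.cong) (auto simp: free_module_def algebra_simps)
  also have "\<dots> = derivation_sum E f + derivation_sum E g"
    using derivation_sum_superset[OF S, of f E] derivation_sum_superset[OF S, of g E]
    by (auto simp: sum.distrib)
  finally show ?thesis .
qed

lemma derivation_sum_smult:
  assumes "c \<in> A" and f: "f \<in> carrier free"
  shows "derivation_sum E (c \<odot>\<^bsub>free\<^esub> f) = c * derivation_sum E f"
proof -
  have "derivation_sum E (c \<odot>\<^bsub>free\<^esub> f) = (\<Sum>a\<in>{a \<in> A. f a \<noteq> 0}. (c \<odot>\<^bsub>free\<^esub> f) a * E a)"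
    using free_carrierD(2)[OF f] by (rule derivation_sum_superset) (auto simp: free_module_def)
  also have "\<dots> = (\<Sum>a\<in>{a \<in> A. f a \<noteq> 0}. c * (f a * E a))"
    by (rule sum.cong) (auto simp: free_module_def algebra_simps)
  finally show ?thesis
    by (simp add: derivation_sum_def sum_distrib_left)
qed

lemma derivation_sum_mem:
  assumes "\<And>a. a \<in> A \<Longrightarrow> E a \<in> A" and f: "f \<in> carrier free"
  shows "derivation_sum E f \<in> A"
proof -
  have "(\<Sum>a\<in>S. f a * E a) \<in> A" if "S \<subseteq> A" for S
    using that
    by (induction S rule: infinite_finite_induct)
      (auto simp: zero_mem intro!: add_mem mult_mem assms free_carrierD[OF f])
  then show ?thesis
    unfolding derivation_sum_def by simp
qed

end


section \<open>Polynomials and Veronese exponents\<close>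

abbreviation "coefficient \<equiv> Poly_Mapping.lookup"
abbreviation "exponent \<equiv> Poly_Mapping.lookup"
abbreviation "exponents \<equiv> Poly_Mapping.keys"
abbreviation "monomial \<equiv> Poly_Mapping.single"

lemma polynomial_as_sum:
  fixes f :: "'a \<Rightarrow>\<^sub>0 'b::comm_monoid_add"
  shows "f = (\<Sum>\<alpha>\<in>exponents f. monomial \<alpha> (coefficient f \<alpha>))"
proof (rule poly_mapping_eqI)
  fix \<beta>
  have "(\<Sum>\<alpha>\<in>exponents f. coefficient (monomial \<alpha> (coefficient f \<alpha>)) \<beta>) =
      (\<Sum>\<alpha>\<in>exponents f. if \<alpha> = \<beta> then coefficient f \<alpha> else 0)"
    by (intro sum.cong) (auto simp: lookup_single)
  then show "coefficient f \<beta> = coefficient (\<Sum>\<alpha>\<in>exponents f. monomial \<alpha> (coefficient f \<alpha>)) \<beta>"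
    by (auto simp: lookup_sum in_keys_iff)
qed

lemma polynomial_additive_induct [case_names zero monomial add]:
  fixes f :: "'a \<Rightarrow>\<^sub>0 'b::comm_monoid_add"
  assumes "P 0" and "\<And>\<alpha> c. P (monomial \<alpha> c)" and "\<And>f g. P f \<Longrightarrow> P g \<Longrightarrow> P (f + g)"
  shows "P f"
proof -
  have "P (\<Sum>\<alpha>\<in>S. monomial \<alpha> (coefficient f \<alpha>))" for S
    by (induction S rule: infinite_finite_induct) (simp_all add: assms)
  then show ?thesis
    using polynomial_as_sum[of f] by metis
qed

lemma coefficient_monomial_mult:
  fixes g :: "'k::comm_semiring_1 polynomials"
  shows "coefficient (monomial \<beta> c * g) (\<beta> + \<alpha>) = c * coefficient g \<alpha>"
  by (induction g rule: polynomial_additive_induct)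
    (simp_all add: mult_single lookup_single when_def lookup_add algebra_simps)

text \<open>Split off the constant term of \<open>f\<close>. The hypothesis says that no product of
  a monomial in the remainder with a monomial of \<open>g\<close> has exponent
  \<open>\<alpha>\<close>, so only the constant term contributes.\<close>

lemma coefficient_mult_constant:
  fixes f g :: "'k::comm_ring_1 polynomials"
  assumes "\<And>\<beta> \<gamma>. \<beta> \<in> exponents f \<Longrightarrow> \<gamma> \<in> exponents g \<Longrightarrow> \<beta> \<noteq> 0 \<Longrightarrow> \<beta> + \<gamma> \<noteq> \<alpha>"
  shows "coefficient (f * g) \<alpha> = coefficient f 0 * coefficient g \<alpha>"
proof -
  define f' where "f' = f - monomial 0 (coefficient f 0)"
  have keys: "exponents f' \<subseteq> exponents f - {0}"
    by (auto simp: f'_def in_keys_iff lookup_minus lookup_single when_def split: if_splits)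
  have "\<alpha> \<notin> exponents (f' * g)"
    using keys_mult[of f' g] keys assms by blast
  moreover have "f * g = monomial 0 (coefficient f 0) * g + f' * g"
    by (simp add: f'_def algebra_simps)
  ultimately show ?thesis
    using coefficient_monomial_mult[of 0 "coefficient f 0" g \<alpha>] by (simp add: lookup_add in_keys_iff)
qed

lemma monomial_eq_0_iff [simp]: "monomial \<alpha> c = 0 \<longleftrightarrow> c = 0"
  by (metis lookup_single_eq lookup_zero single_zero)

lemma exponent_sum_eq_zero_iff [simp]: "(\<alpha> :: nat \<Rightarrow>\<^sub>0 nat) + \<beta> = 0 \<longleftrightarrow> \<alpha> = 0 \<and> \<beta> = 0"
  by (auto simp: poly_mapping_eq_iff fun_eq_iff lookup_add)

lemma coefficient_mult_0:
  "coefficient (f * g) 0 = coefficient f 0 * coefficient (g :: 'k::comm_ring_1 polynomials) 0"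
  by (rule coefficient_mult_constant) simp

text \<open>The derivation \<open>x_i d/dx_i\<close>, diagonal on monomials. Unlike
  \<open>d/dx_i\<close> it preserves the degree, so it restricts to the Veronese ring.\<close>

definition euler :: "nat \<Rightarrow> 'k::field polynomials \<Rightarrow> 'k polynomials" where
  "euler i = Poly_Mapping.mapp (\<lambda>\<alpha> c. of_nat (exponent \<alpha> i) * c)"

lemma coefficient_euler: "coefficient (euler i f) \<alpha> = of_nat (exponent \<alpha> i) * coefficient f \<alpha>"
  by (simp add: euler_def lookup_mapp when_def in_keys_iff)

lemma euler_zero [simp]: "euler i 0 = 0"
  by (rule poly_mapping_eqI) (simp add: coefficient_euler)

lemma euler_add: "euler i (f + g) = euler i f + euler i g"
  by (rule poly_mapping_eqI) (simp add: coefficient_euler lookup_add algebra_simps)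

lemma euler_monomial: "euler i (monomial \<alpha> c) = monomial \<alpha> (of_nat (exponent \<alpha> i) * c)"
  by (rule poly_mapping_eqI) (simp add: coefficient_euler lookup_single when_def)

lemma euler_mult: "euler i (f * g) = f * euler i g + g * euler i f"
proof (induction f rule: polynomial_additive_induct)
  case zero
  then show ?case by simp
next
  case (monomial \<alpha> a)
  show ?case
  proof (induction g rule: polynomial_additive_induct)
    case zero
    then show ?case by simp
  next
    case (monomial \<beta> b)
    then show ?case
      by (simp add: euler_monomial mult_single lookup_add add.commute[of \<beta> \<alpha>] single_add[symmetric] algebra_simps)
  next
    case (add g h)
    then show ?case by (simp add: euler_add algebra_simps)
  qed
next
  case (add f h)
  then show ?case by (simp add: euler_add algebra_simps)
qed

lemma exponents_euler: "exponents (euler i f) \<subseteq> exponents f"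
  by (auto simp: euler_def dest: subsetD[OF keys_mapp_subset])

section \<open>Degrees and the monomial basis of the Veronese ring\<close>

definition total_degree :: "nat \<Rightarrow> (nat \<Rightarrow>\<^sub>0 nat) \<Rightarrow> nat" where
  "total_degree r \<alpha> = (\<Sum>i\<le>r. exponent \<alpha> i)"

lemma total_degree_add [simp]: "total_degree r (\<alpha> + \<beta>) = total_degree r \<alpha> + total_degree r \<beta>"
  by (simp add: total_degree_def lookup_add sum.distrib)

lemma total_degree_zero [simp]: "total_degree r 0 = 0"
  by (simp add: total_degree_def)

lemma total_degree_single [simp]: "i \<le> r \<Longrightarrow> total_degree r (Poly_Mapping.single i n) = n"
  by (simp add: total_degree_def lookup_single when_def)

lemma total_degree_eq_0_iff: "exponents \<alpha> \<subseteq> {..r} \<Longrightarrow> total_degree r \<alpha> = 0 \<longleftrightarrow> \<alpha> = 0"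
  by (auto simp: total_degree_def poly_mapping_eq_iff fun_eq_iff in_keys_iff subset_iff)

lemma exponents_add_nat: "exponents ((\<alpha> :: nat \<Rightarrow>\<^sub>0 nat) + \<beta>) = exponents \<alpha> \<union> exponents \<beta>"
  by (auto simp: in_keys_iff lookup_add)

definition veronese_exponents :: "nat \<Rightarrow> nat \<Rightarrow> (nat \<Rightarrow>\<^sub>0 nat) set" where
  "veronese_exponents r d = {\<alpha>. exponents \<alpha> \<subseteq> {..r} \<and> d dvd total_degree r \<alpha>}"

lemma veronese_exponents_add:
  "\<alpha> \<in> veronese_exponents r d \<Longrightarrow> \<beta> \<in> veronese_exponents r d \<Longrightarrow> \<alpha> + \<beta> \<in> veronese_exponents r d"
  by (simp add: veronese_exponents_def exponents_add_nat)

text \<open>Variables are moved from one factor to the other one at a time. With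
  \<open>j = d\<close> this peels a generator off a monomial whose degree is a larger multiple of
  \<open>d\<close>.\<close>

lemma exponent_split:
  assumes "j \<le> total_degree r \<alpha>" "exponents \<alpha> \<subseteq> {..r}"
  shows "\<exists>\<beta> \<gamma>. \<alpha> = \<beta> + \<gamma> \<and> total_degree r \<beta> = j"
  using assms(1)
proof (induction j)
  case 0
  show ?case by (rule exI[of _ 0]) simp
next
  case (Suc j)
  then obtain \<beta> \<gamma> where \<beta>: "\<alpha> = \<beta> + \<gamma>" "total_degree r \<beta> = j" by auto
  then have "total_degree r \<gamma> \<noteq> 0" using Suc.prems by simp
  then obtain i where i: "i \<le> r" "exponent \<gamma> i \<noteq> 0"
    by (auto simp: total_degree_def)
  let ?e = "Poly_Mapping.single i (1::nat)"
  have "\<gamma> = ?e + (\<gamma> - ?e)"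
    using i by (intro poly_mapping_eqI) (auto simp: lookup_add lookup_minus lookup_single when_def)
  then have "\<alpha> = (\<beta> + ?e) + (\<gamma> - ?e)"
    using \<beta>(1) by (simp add: add.assoc)
  moreover have "total_degree r (\<beta> + ?e) = Suc j"
    using \<beta>(2) i by simp
  ultimately show ?case by blast
qed

lemma generated_subalgebra_zero: "0 \<in> generated_subalgebra G"
  using generated_subalgebra.scalar[of 0 G] by (simp add: scalar_def)

lemma generated_subalgebra_one: "1 \<in> generated_subalgebra G"
  using generated_subalgebra.scalar[of 1 G] by (simp add: scalar_def)

lemma generated_subalgebra_sum:
  "(\<And>a. a \<in> S \<Longrightarrow> f a \<in> generated_subalgebra G) \<Longrightarrow> sum f S \<in> generated_subalgebra G"
  by (induction S rule: infinite_finite_induct)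
    (auto intro: generated_subalgebra_zero generated_subalgebra.add)

lemma monomial_in_veronese:
  assumes "\<alpha> \<in> veronese_exponents r d"
  shows "monomial \<alpha> c \<in> generated_subalgebra (degree_monomials r d :: 'k::field polynomials set)"
proof -
  have "monomial \<alpha> 1 \<in> generated_subalgebra (degree_monomials r d :: 'k polynomials set)"
    if "total_degree r \<alpha> = d * k" "exponents \<alpha> \<subseteq> {..r}" for k
    using that
  proof (induction k arbitrary: \<alpha>)
    case 0
    then show ?case using total_degree_eq_0_iff generated_subalgebra_one by fastforce
  next
    case (Suc k)
    obtain \<beta> \<gamma> where \<beta>: "\<alpha> = \<beta> + \<gamma>" "total_degree r \<beta> = d"
      using exponent_split[of d r \<alpha>] Suc.prems by auto
    have "monomial \<gamma> 1 \<in> generated_subalgebra (degree_monomials r d :: 'k polynomials set)"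
      using Suc \<beta> by (intro Suc.IH) (auto simp: exponents_add_nat)
    moreover have "monomial \<beta> 1 \<in> generated_subalgebra (degree_monomials r d :: 'k polynomials set)"
      using Suc.prems \<beta> by (intro generated_subalgebra.generator)
        (auto simp: degree_monomials_def total_degree_def exponents_add_nat)
    ultimately show ?case
      using generated_subalgebra.mult by (fastforce simp: \<beta>(1) mult_single)
  qed
  moreover obtain k where "total_degree r \<alpha> = d * k" "exponents \<alpha> \<subseteq> {..r}"
    using assms by (auto simp: veronese_exponents_def)
  ultimately have "monomial \<alpha> 1 \<in> generated_subalgebra (degree_monomials r d :: 'k polynomials set)"
    by blast
  then have "scalar c * monomial \<alpha> 1 \<in> generated_subalgebra (degree_monomials r d :: 'k polynomials set)"
    by (rule generated_subalgebra.mult[OF generated_subalgebra.scalar])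
  then show ?thesis
    by (simp add: scalar_def mult_single)
qed

text \<open>Monomials of degree \<open>d * k\<close> factor into \<open>k\<close> generators, and
  conversely these exponents are closed under addition. Membership in the ring can therefore be
  checked exponent by exponent.\<close>

lemma in_veronese_iff:
  "f \<in> generated_subalgebra (degree_monomials r d) \<longleftrightarrow> exponents f \<subseteq> veronese_exponents r d"
proof
  assume "f \<in> generated_subalgebra (degree_monomials r d)"
  then show "exponents f \<subseteq> veronese_exponents r d"
  proof induction
    case (generator g)
    then show ?case
      by (auto simp: degree_monomials_def veronese_exponents_def total_degree_def)
  next
    case (scalar c)
    then show ?case
      by (simp add: scalar_def veronese_exponents_def)
  next
    case (add f g)
    then show ?case using Poly_Mapping.keys_add[of f g] by blast
  next
    case (mult f g)
    then show ?case using keys_mult[of f g] veronese_exponents_add by blast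
  qed
next
  assume "exponents f \<subseteq> veronese_exponents r d"
  then have "(\<Sum>\<alpha>\<in>exponents f. monomial \<alpha> (coefficient f \<alpha>)) \<in> generated_subalgebra (degree_monomials r d)"
    by (intro generated_subalgebra_sum monomial_in_veronese) auto
  then show "f \<in> generated_subalgebra (degree_monomials r d)"
    using polynomial_as_sum[of f] by metis
qed

text \<open>
  The hypothesis is what the Leibniz rule gives for the relation between the three monomials;
  it forces the first variable to divide \<open>g\<close>.
\<close>

lemma veronese_quotient:
  fixes g h e :: "'k::field polynomials"
  defines "x\<^sub>0 \<equiv> monomial (Poly_Mapping.single 0 1) 1" and "x\<^sub>1 \<equiv> monomial (Poly_Mapping.single 1 1) 1"
  assumes "r \<ge> 1" and g: "exponents g \<subseteq> veronese_exponents r d"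
    and rel: "x\<^sub>0 * x\<^sub>1 * h = x\<^sub>0 * x\<^sub>0 * e + x\<^sub>1 * x\<^sub>1 * g"
  obtains q where "exponents q \<subseteq> veronese_exponents r d" "x\<^sub>0 * q = x\<^sub>1 * g"
proof -
  let ?e\<^sub>0 = "Poly_Mapping.single 0 1 :: nat \<Rightarrow>\<^sub>0 nat" and ?e\<^sub>1 = "Poly_Mapping.single 1 1 :: nat \<Rightarrow>\<^sub>0 nat"
  \<comment> \<open>The relation shows that \<open>x\<^sub>0\<close> divides
    \<open>x\<^sub>1 * x\<^sub>1 * g\<close>. Multiplication by \<open>x\<^sub>1 * x\<^sub>1\<close>
    shifts exponents injectively and leaves the exponent of \<open>x\<^sub>0\<close> alone, so each
    monomial of \<open>g\<close> already contains \<open>x\<^sub>0\<close>. Hence the truncated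
    subtraction loses nothing.\<close>
  have split: "\<alpha> = ?e\<^sub>0 + (\<alpha> - ?e\<^sub>0)" if \<alpha>: "\<alpha> \<in> exponents g" for \<alpha>
  proof -
    have "x\<^sub>1 * x\<^sub>1 * g = x\<^sub>0 * (x\<^sub>1 * h - x\<^sub>0 * e)"
      using rel by (simp add: algebra_simps)
    moreover have "coefficient (x\<^sub>1 * x\<^sub>1 * g) (?e\<^sub>1 + ?e\<^sub>1 + \<alpha>) \<noteq> 0"
      using coefficient_monomial_mult[of "?e\<^sub>1 + ?e\<^sub>1" 1 g \<alpha>] \<alpha> by (simp add: x\<^sub>1_def mult_single in_keys_iff)
    ultimately have "?e\<^sub>1 + ?e\<^sub>1 + \<alpha> \<in> exponents (x\<^sub>0 * (x\<^sub>1 * h - x\<^sub>0 * e))"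
      by (simp add: in_keys_iff)
    then obtain \<beta> where "?e\<^sub>1 + ?e\<^sub>1 + \<alpha> = ?e\<^sub>0 + \<beta>"
      using keys_mult[of x\<^sub>0 "x\<^sub>1 * h - x\<^sub>0 * e"] by (auto simp: x\<^sub>0_def)
    from arg_cong[where f = "\<lambda>\<gamma>. exponent \<gamma> 0", OF this] have "exponent \<alpha> 0 \<ge> 1"
      by (simp add: lookup_add lookup_single when_def)
    then show ?thesis
      by (intro poly_mapping_eqI) (auto simp: lookup_add lookup_minus lookup_single when_def)
  qed
  \<comment> \<open>This is \<open>(x\<^sub>1 / x\<^sub>0) * g\<close>: one factor
    \<open>x\<^sub>0\<close> is exchanged for \<open>x\<^sub>1\<close> in every monomial. The
    exchange preserves the degree, so \<open>q\<close> remains in the Veronese ring; dividing by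
    \<open>x\<^sub>0\<close> alone would leave it when \<open>d \<ge> 2\<close> and \<open>g\<close>
    is nonzero.\<close>
  define q where "q = (\<Sum>\<alpha>\<in>exponents g. monomial (?e\<^sub>1 + (\<alpha> - ?e\<^sub>0)) (coefficient g \<alpha>))"
  have "x\<^sub>0 * q = (\<Sum>\<alpha>\<in>exponents g. monomial (?e\<^sub>1 + (?e\<^sub>0 + (\<alpha> - ?e\<^sub>0))) (coefficient g \<alpha>))"
    by (simp add: q_def x\<^sub>0_def sum_distrib_left mult_single add.left_commute)
  also have "\<dots> = (\<Sum>\<alpha>\<in>exponents g. x\<^sub>1 * monomial \<alpha> (coefficient g \<alpha>))"
    using split by (intro sum.cong) (simp_all add: x\<^sub>1_def mult_single)
  also have "\<dots> = x\<^sub>1 * g"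
    using polynomial_as_sum[of g] by (metis sum_distrib_left)
  finally have eq: "x\<^sub>0 * q = x\<^sub>1 * g" .
  have "?e\<^sub>1 + (\<alpha> - ?e\<^sub>0) \<in> veronese_exponents r d" if \<alpha>: "\<alpha> \<in> exponents g" for \<alpha>
  proof -
    have "\<alpha> \<in> veronese_exponents r d" using g \<alpha> by auto
    then have *: "?e\<^sub>0 + (\<alpha> - ?e\<^sub>0) \<in> veronese_exponents r d" using split[OF \<alpha>] by simp
    then show ?thesis
      using \<open>r \<ge> 1\<close> by (simp add: veronese_exponents_def exponents_add_nat)
  qed
  then have "q \<in> generated_subalgebra (degree_monomials r d)"
    unfolding q_def by (intro generated_subalgebra_sum monomial_in_veronese)
  with eq show ?thesis
    using that by (simp add: in_veronese_iff)
qed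

text \<open>The ring has nothing in degrees strictly between \<open>0\<close> and \<open>d\<close>.
  A product of two nonconstant monomials has degree at least \<open>2 * d\<close>, so in degree
  \<open>d\<close> only the constant term of \<open>f\<close> acts.\<close>

lemma veronese_coefficient_mult:
  assumes f: "exponents f \<subseteq> veronese_exponents r d"
    and g: "exponents (g :: 'k::field polynomials) \<subseteq> veronese_exponents r d" "coefficient g 0 = 0"
    and \<alpha>: "total_degree r \<alpha> = d" and "d > 0"
  shows "coefficient (f * g) \<alpha> = coefficient f 0 * coefficient g \<alpha>"
proof (rule coefficient_mult_constant)
  fix \<beta> \<gamma> assume \<beta>: "\<beta> \<in> exponents f" "\<beta> \<noteq> 0" and \<gamma>: "\<gamma> \<in> exponents g"
  have "\<gamma> \<noteq> 0" using \<gamma> g(2) by (auto simp: in_keys_iff)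
  have "total_degree r \<delta> \<ge> d" if "\<delta> \<in> veronese_exponents r d" "\<delta> \<noteq> 0" for \<delta>
    using that total_degree_eq_0_iff[of \<delta> r] by (auto simp: veronese_exponents_def dest: dvd_imp_le)
  then have "total_degree r \<beta> \<ge> d" "total_degree r \<gamma> \<ge> d"
    using \<beta> \<gamma> f g(1) \<open>\<gamma> \<noteq> 0\<close> by auto
  then have "total_degree r (\<beta> + \<gamma>) > d" using \<open>d > 0\<close> by simp
  then show "\<beta> + \<gamma> \<noteq> \<alpha>" using \<alpha> by auto
qed


section \<open>Functionals on differentials from derivations\<close>

context subdomain
begin

definition is_derivation :: "'a set \<Rightarrow> ('a \<Rightarrow> 'a) \<Rightarrow> bool" where
  "is_derivation K E \<longleftrightarrow> (\<forall>a\<in>A. E a \<in> A) \<and> (\<forall>a\<in>A. \<forall>b\<in>A. E (a + b) = E a + E b) \<and>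
    (\<forall>a\<in>A. \<forall>b\<in>A. E (a * b) = a * E b + b * E a) \<and> (\<forall>c\<in>K. E c = 0)"

abbreviation "relations K \<equiv> submodule_generated R free (kaehler_relations R K)"

lemma submodule_relations: "submodule (relations K) R free"
  using submodule_kaehler[OF cring_R] by simp

lemma derivation_sum_generator: "a \<in> A \<Longrightarrow> derivation_sum E (free_generator R A a) = E a"
  using derivation_sum_superset[of "{a}" "free_generator R A a" E]
  by (auto simp: free_generator_def)

lemma derivation_sum_diff:
  assumes f: "f \<in> carrier free" and g: "g \<in> carrier free"
  shows "derivation_sum E (f \<ominus>\<^bsub>free\<^esub> g) = derivation_sum E f - derivation_sum E g"
proof -
  interpret F: module R free by (rule module_free)
  have "f = (f \<ominus>\<^bsub>free\<^esub> g) \<oplus>\<^bsub>free\<^esub> g"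
    using f g by (simp add: a_minus_def F.M.a_assoc F.M.l_neg)
  then have "derivation_sum E f = derivation_sum E (f \<ominus>\<^bsub>free\<^esub> g) + derivation_sum E g"
    using derivation_sum_add[OF F.M.minus_closed[OF f g] g] by simp
  then show ?thesis by simp
qed

text \<open>The kernel of the linear extension is a submodule, and the derivation laws say exactly
  that it contains the defining relations; hence it contains the submodule they generate.\<close>

lemma derivation_sum_relations:
  assumes E: "is_derivation K E" and "K \<subseteq> A" and n: "n \<in> relations K"
  shows "derivation_sum E n = 0"
proof -
  interpret F: module R free by (rule module_free)
  let ?H = "{f \<in> carrier free. derivation_sum E f = 0}"
  have zero: "derivation_sum E \<zero>\<^bsub>free\<^esub> = 0"
    by (auto simp: derivation_sum_def free_module_def intro!: sum.neutral)
  have "submodule ?H R free"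
  proof (rule F.submoduleI)
    fix f assume "f \<in> ?H"
    then show "\<ominus>\<^bsub>free\<^esub> f \<in> ?H"
      using derivation_sum_diff[OF F.M.zero_closed, of f E] zero by (simp add: a_minus_def)
  qed (auto simp: zero derivation_sum_add derivation_sum_smult)
  moreover have "kaehler_relations R K \<subseteq> ?H"
  proof
    fix f assume f: "f \<in> kaehler_relations R K"
    then have "f \<in> carrier free"
      using kaehler_relations_subset[OF cring_R] by auto
    moreover have "derivation_sum E f = 0"
      using f E \<open>K \<subseteq> A\<close> free_generator_in_carrier[OF cring_R, of A]
      by (auto simp: kaehler_relations_def Let_def is_derivation_def derivation_sum_diff
          derivation_sum_add derivation_sum_smult derivation_sum_generator add_mem mult_mem subset_iff)
    ultimately show "f \<in> ?H" by simp
  qed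
  ultimately show ?thesis
    using n submodule_generated_least[of ?H R free] by blast
qed

text \<open>The linear form on differentials that corresponds to the derivation \<open>E\<close>.
  The chosen representative is immaterial, as \<open>kaehler_functional_coset\<close> shows.\<close>

definition kaehler_functional :: "'a set \<Rightarrow> ('a \<Rightarrow> 'a) \<Rightarrow> ('a \<Rightarrow> 'a) set \<Rightarrow> 'a" where
  "kaehler_functional K E = (\<lambda>C\<in>carrier (kaehler_module R K). derivation_sum E (SOME f. f \<in> C))"

lemma kaehler_carrier: "carrier (kaehler_module R K) = (\<lambda>f. relations K +>\<^bsub>free\<^esub> f) ` carrier free"
  using quotient_module_carrier[OF module_free submodule_relations] by (simp add: kaehler_module_def Let_def)

lemma kaehler_functional_coset:
  assumes E: "is_derivation K E" and K: "K \<subseteq> A" and f: "f \<in> carrier free"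
  shows "kaehler_functional K E (relations K +>\<^bsub>free\<^esub> f) = derivation_sum E f"
proof -
  interpret F: module R free by (rule module_free)
  interpret N: submodule "relations K" R free by (rule submodule_relations)
  have eq: "derivation_sum E g = derivation_sum E f" if g: "g \<in> relations K +>\<^bsub>free\<^esub> f" for g
  proof -
    obtain n where n: "n \<in> relations K" "g = n \<oplus>\<^bsub>free\<^esub> f"
      using g by (auto simp: a_r_coset_def')
    moreover have "n \<in> carrier free"
      using n(1) F.submoduleE(1)[OF submodule_relations] by auto
    ultimately show ?thesis
      using derivation_sum_add[OF _ f] derivation_sum_relations[OF E K] by simp
  qed
  have "\<zero>\<^bsub>free\<^esub> \<in> relations K"
    using N.one_closed by simp
  then have "f \<in> relations K +>\<^bsub>free\<^esub> f"
    using f by (force simp: a_r_coset_def')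
  then have "(SOME g. g \<in> relations K +>\<^bsub>free\<^esub> f) \<in> relations K +>\<^bsub>free\<^esub> f"
    by (rule someI[where P = "\<lambda>g. g \<in> relations K +>\<^bsub>free\<^esub> f"])
  then show ?thesis
    using eq f by (simp add: kaehler_functional_def kaehler_carrier)
qed

lemma kaehler_functional_linear:
  assumes E: "is_derivation K E" and K: "K \<subseteq> A"
  shows "kaehler_functional K E \<in> linear_maps A (kaehler_module R K) (self_module R)"
proof -
  interpret F: module R free by (rule module_free)
  note coset = kaehler_functional_coset[OF E K]
  note ops = quotient_module_add[OF module_free submodule_relations]
    quotient_module_smult[OF module_free submodule_relations]
  have mem: "derivation_sum E f \<in> A" if "f \<in> carrier free" for f
    using E that by (intro derivation_sum_mem) (auto simp: is_derivation_def)
  have "kaehler_functional K E x \<in> A" if "x \<in> carrier (kaehler_module R K)" for x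
    using that mem by (auto simp: kaehler_carrier coset)
  moreover have "kaehler_functional K E (x \<oplus>\<^bsub>kaehler_module R K\<^esub> y) =
      kaehler_functional K E x + kaehler_functional K E y"
    if "x \<in> carrier (kaehler_module R K)" "y \<in> carrier (kaehler_module R K)" for x y
    using that ops(1) unfolding kaehler_carrier
    by (auto simp: coset derivation_sum_add kaehler_module_def Let_def)
  moreover have "kaehler_functional K E (a \<odot>\<^bsub>kaehler_module R K\<^esub> x) = a * kaehler_functional K E x"
    if "a \<in> A" "x \<in> carrier (kaehler_module R K)" for a x
    using that ops(2) unfolding kaehler_carrier
    by (auto simp: coset derivation_sum_smult kaehler_module_def Let_def)
  ultimately show ?thesis
    by (auto simp: linear_maps_def kaehler_functional_def)
qed

lemma kaehler_functional_differential:
  assumes "is_derivation K E" and "K \<subseteq> A" and "a \<in> A"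
  shows "kaehler_functional K E (differential R K a) = E a"
  using kaehler_functional_coset[OF assms(1,2) free_generator_in_carrier[OF cring_R]] assms(3)
  by (simp add: differential_def derivation_sum_generator)

lemma subdomain_module_kaehler: "subdomain_module A R (kaehler_module R K)"
  by (intro subdomain_module.intro subdomain_axioms subdomain_module_axioms.intro module_kaehler_module cring_R)

end


section \<open>The cone over a Veronese variety\<close>

abbreviation "veronese_algebra r d \<equiv> generated_subalgebra (degree_monomials r d)"

lemma subdomain_veronese:
  "subdomain (veronese_algebra r d) (veronese_cone_ring r d :: 'k::field polynomials ring)"
proof
  fix a :: "'k polynomials" assume "a \<in> veronese_algebra r d"
  then have "scalar (-1) * a \<in> veronese_algebra r d"
    by (rule generated_subalgebra.mult[OF generated_subalgebra.scalar])
  then show "- a \<in> veronese_algebra r d"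
    by (simp add: scalar_def single_uminus)
qed (auto simp: veronese_cone_ring_def generated_subalgebra_one intro: generated_subalgebra.intros)

text \<open>The homogeneous maximal ideal. Denominators at this point are exactly the ring elements
  with nonzero constant term.\<close>

definition vertex :: "nat \<Rightarrow> nat \<Rightarrow> 'k::field polynomials set" where
  "vertex r d = {f \<in> veronese_algebra r d. coefficient f 0 = 0}"

lemma primeideal_vertex: "primeideal (vertex r d) (veronese_cone_ring r d :: 'k::field polynomials ring)"
proof -
  interpret S: subdomain "veronese_algebra r d" "veronese_cone_ring r d :: 'k polynomials ring"
    by (rule subdomain_veronese)
  interpret S: cring "veronese_cone_ring r d :: 'k polynomials ring" by (rule S.cring_R)
  have inv: "\<ominus>\<^bsub>veronese_cone_ring r d\<^esub> a = - a" if "a \<in> veronese_algebra r d" for a :: "'k polynomials"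
    using that by (intro S.minus_equality) (auto simp: S.uminus_mem)
  show ?thesis
  proof (rule primeidealI[OF idealI])
    show "ring (veronese_cone_ring r d :: 'k polynomials ring)" by (rule S.ring_axioms)
    show "subgroup (vertex r d) (add_monoid (veronese_cone_ring r d :: 'k polynomials ring))"
      by (rule S.add.subgroupI)
        (auto simp: vertex_def inv lookup_add S.add_mem S.uminus_mem S.zero_mem intro: exI[of _ 0])
    have "1 \<notin> (vertex r d :: 'k polynomials set)" by (simp add: vertex_def)
    then show "carrier (veronese_cone_ring r d) \<noteq> (vertex r d :: 'k polynomials set)"
      using S.one_mem by auto
  qed (auto simp: vertex_def coefficient_mult_0 S.mult_mem S.cring_axioms)
qed

lemma is_derivation_euler:
  "subdomain.is_derivation (veronese_algebra r d) (range scalar) (euler i :: 'k::field polynomials \<Rightarrow> _)"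
  unfolding subdomain.is_derivation_def[OF subdomain_veronese]
proof (intro conjI ballI)
  fix a :: "'k polynomials" assume "a \<in> veronese_algebra r d"
  then show "euler i a \<in> veronese_algebra r d"
    using exponents_euler[of i a] by (auto simp: in_veronese_iff)
qed (auto simp: euler_add euler_mult scalar_def euler_monomial)

text \<open>An Euler derivative has no constant term, so in degree \<open>d\<close> only the
  constant terms of the \<open>f a\<close> contribute. The derivation appears on the right only
  through the factor \<open>exponent \<alpha> i\<close>: the sum is the same for every
  \<open>i\<close>, so two derivations can be compared.\<close>

lemma coefficient_derivation_sum_euler:
  fixes f :: "'k::field polynomials \<Rightarrow> 'k polynomials"
  assumes f: "f \<in> carrier (free_module (veronese_cone_ring r d) (veronese_algebra r d))"
    and \<alpha>: "total_degree r \<alpha> = d" and "d > 0"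
  shows "coefficient (subdomain.derivation_sum (veronese_algebra r d) (euler i) f) \<alpha> =
    of_nat (exponent \<alpha> i) * (\<Sum>a\<in>{a \<in> veronese_algebra r d. f a \<noteq> 0}. coefficient (f a) 0 * coefficient a \<alpha>)"
proof -
  interpret S: subdomain "veronese_algebra r d" "veronese_cone_ring r d :: 'k polynomials ring"
    by (rule subdomain_veronese)
  have "coefficient (f a * euler i a) \<alpha> = of_nat (exponent \<alpha> i) * (coefficient (f a) 0 * coefficient a \<alpha>)"
    if "a \<in> veronese_algebra r d" for a
  proof -
    have "coefficient (f a * euler i a) \<alpha> = coefficient (f a) 0 * coefficient (euler i a) \<alpha>"
      using S.free_carrierD(1)[OF f that] that exponents_euler[of i a] \<alpha> \<open>d > 0\<close>
      by (intro veronese_coefficient_mult[of _ r d]) (auto simp: in_veronese_iff coefficient_euler)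
    then show ?thesis
      by (simp add: coefficient_euler)
  qed
  then show ?thesis
    by (simp add: S.derivation_sum_def lookup_sum sum_distrib_left)
qed

theorem proposition4p3:
  fixes r d :: nat
  assumes "r \<ge> 1" and "d \<ge> 2"
  shows "has_cotorsion (veronese_cone_ring r d :: 'k::field_char_0 polynomials ring)
    (veronese_cone_differentials r d)"
proof -
  let ?A = "veronese_algebra r d :: 'k polynomials set"
  define R where "R = (veronese_cone_ring r d :: 'k polynomials ring)"
  define K where "K = (range scalar :: 'k polynomials set)"
  interpret S: subdomain ?A R
    unfolding R_def by (rule subdomain_veronese)
  define M where "M = kaehler_module R K"
  interpret S: subdomain_module ?A R M
    unfolding M_def by (rule S.subdomain_module_kaehler)
  have K: "K \<subseteq> ?A"
    by (auto simp: K_def intro: generated_subalgebra.scalar)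
  let ?e\<^sub>0 = "Poly_Mapping.single 0 1 :: nat \<Rightarrow>\<^sub>0 nat" and ?e\<^sub>1 = "Poly_Mapping.single 1 1 :: nat \<Rightarrow>\<^sub>0 nat"
  let ?x\<^sub>0 = "monomial ?e\<^sub>0 1 :: 'k polynomials" and ?x\<^sub>1 = "monomial ?e\<^sub>1 1 :: 'k polynomials"
  \<comment> \<open>\<open>\<pi>\<close> is the exponent of \<open>x\<^sub>0^(d-2)\<close>, the
    common factor of \<open>y\<close>, \<open>z\<close> and \<open>u\<close>; here
    \<open>d \<ge> 2\<close> keeps the subtraction from truncating. \<open>\<alpha>\<close> is the
    exponent of \<open>z\<close>.\<close>
  define \<pi> where "\<pi> = Poly_Mapping.single (0::nat) (d - 2)"
  define \<alpha> where "\<alpha> = \<pi> + ?e\<^sub>0 + ?e\<^sub>1"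
  define y where "y = monomial \<pi> 1 * ?x\<^sub>0 * ?x\<^sub>0"
  define z where "z = monomial \<pi> 1 * ?x\<^sub>0 * ?x\<^sub>1"
  define u where "u = monomial \<pi> 1 * ?x\<^sub>1 * ?x\<^sub>1"
  have y_eq: "y = monomial (\<pi> + ?e\<^sub>0 + ?e\<^sub>0) 1" and z_eq: "z = monomial \<alpha> 1"
    and u_eq: "u = monomial (\<pi> + ?e\<^sub>1 + ?e\<^sub>1) 1"
    by (simp_all add: y_def z_def u_def \<alpha>_def mult_single)
  have \<alpha>_deg: "total_degree r \<alpha> = d"
    using assms by (simp add: \<alpha>_def \<pi>_def)
  have \<alpha>_exp: "exponent \<alpha> 0 = d - 1" "exponent \<alpha> 1 = 1"
    using assms by (simp_all add: \<alpha>_def \<pi>_def lookup_add lookup_single when_def)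
  have d_eq: "Suc (Suc (d - 2)) = d"
    using assms by simp
  have mem: "y \<in> ?A" "z \<in> ?A" "u \<in> ?A"
    using assms unfolding y_eq z_eq u_eq \<alpha>_def \<pi>_def
    by (auto intro!: monomial_in_veronese simp: veronese_exponents_def exponents_add_nat d_eq split: if_splits)
  have y_nz: "y \<noteq> 0"
    by (simp add: y_eq)
  have rel: "z * z = y * u"
    by (simp add: y_def z_def u_def)
  have euler_y: "euler 0 y = scalar (of_nat d) * y" "euler 1 y = 0"
    using assms by (simp_all add: y_eq \<pi>_def euler_monomial scalar_def mult_single lookup_add lookup_single
        when_def d_eq del: single_of_nat)
  have euler_z: "euler 0 z = scalar (of_nat (d - 1)) * z" "euler 1 z = z"
    using \<alpha>_exp by (simp_all add: z_eq euler_monomial scalar_def mult_single del: single_of_nat)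
  let ?\<delta> = "differential R K"
  have \<delta>: "?\<delta> a \<in> carrier M" for a
    unfolding M_def by (rule differential_in_carrier[OF S.cring_R])
  \<comment> \<open>The factor \<open>(d-1)/d\<close> is determined by requiring that the form have
    no \<open>dx\<^sub>0\<close> component: contraction with \<open>euler 0\<close> gives
    \<open>(d-1) z - \<kappa> (z/y) d y\<close>, which must vanish.\<close>
  define \<kappa> where "\<kappa> = (scalar (of_nat (d - 1) / of_nat d) :: 'k polynomials)"
  have \<kappa>_mem: "\<kappa> \<in> ?A"
    by (simp add: \<kappa>_def generated_subalgebra.scalar)
  have \<kappa>: "\<kappa> * scalar (of_nat d) = scalar (of_nat (d - 1))"
    using assms by (simp add: \<kappa>_def scalar_def mult_single del: single_of_nat)
  define c where "c = Fract (\<kappa> * z) y"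
  have reg: "S.regular V (\<lambda>Q. S.pairing V \<phi> (?\<delta> z) Q - c * S.pairing V \<phi> (?\<delta> y) Q)"
    if V: "V \<in> opens_in R U" and \<phi>: "\<phi> \<in> carrier (S.\<D> V)" for U V \<phi>
    unfolding S.regular_def
  proof
    fix P assume P: "P \<in> V"
    obtain W s m where W: "W \<in> opens_in R V" "P \<in> W" and s: "s \<in> ?A" and m: "\<forall>a\<in>{y, z, u}. m a \<in> ?A"
      and eq: "\<forall>Q\<in>W. s \<notin> Q \<and> (\<forall>a\<in>{y, z, u}. S.pairing V \<phi> (?\<delta> a) Q = Fract (m a) s)"
      using S.regular_common_denominator[of "{y, z, u}" V "\<lambda>a. S.pairing V \<phi> (?\<delta> a)" P U]
        S.pairing_section(1)[OF V \<phi> \<delta>] P V by auto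
    have nz: "s \<noteq> 0"
      using S.prime_denominator[OF opens_in_primeideal[OF W], of s] s eq W(2) by auto
    have smult: "a \<odot>\<^bsub>M\<^esub> ?\<delta> b \<in> carrier M" if "a \<in> ?A" for a b
      using module.smult_closed[OF S.module_M _ \<delta>] that by simp
    \<comment> \<open>The rule is applied at the single point \<open>P\<close>. The numerators
      \<open>m\<close> and the denominator \<open>s\<close> are common to all of \<open>W\<close>,
      so an identity between them obtained at \<open>P\<close> serves at every point of
      \<open>W\<close>.\<close>
    have leibniz: "S.pairing V \<phi> (?\<delta> (a * b)) P =
        Fract a 1 * S.pairing V \<phi> (?\<delta> b) P + Fract b 1 * S.pairing V \<phi> (?\<delta> a) P"
      if "a \<in> ?A" "b \<in> ?A" for a b
      using differential_mult[OF S.cring_R, of a b K, folded M_def] that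
        S.pairing_vector_add[OF V \<phi> smult smult P]
        S.pairing_vector_smult[OF V \<phi> _ \<delta> P] by simp
    have "Fract z 1 * Fract (m z) s + Fract z 1 * Fract (m z) s =
        Fract y 1 * Fract (m u) s + Fract u 1 * Fract (m y) s"
      using leibniz[OF mem(2,2)] leibniz[OF mem(1,3)] eq W(2) rel by simp
    \<comment> \<open>Each side is a sum of two fractions with denominator \<open>s\<close>, hence
      has denominator \<open>s * s\<close>; cross multiplication leaves the factor
      \<open>s * s * s\<close>.\<close>
    then have "s * s * s * (z * (2 * m z)) = s * s * s * (y * m u + u * m y)"
      using nz by (simp add: eq_fract algebra_simps)
    moreover have "s * s * s \<noteq> 0"
      using nz by simp
    ultimately have "z * (2 * m z) = y * m u + u * m y"
      using mult_left_cancel by blast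
    \<comment> \<open>Cancelling the common factor \<open>monomial \<pi> 1\<close> gives the
      hypothesis of \<open>veronese_quotient\<close> with \<open>h = 2 * m z\<close>,
      \<open>e = m u\<close> and \<open>g = m y\<close>.\<close>
    then have "monomial \<pi> 1 * (?x\<^sub>0 * ?x\<^sub>1 * (2 * m z)) = monomial \<pi> 1 * (?x\<^sub>0 * ?x\<^sub>0 * m u + ?x\<^sub>1 * ?x\<^sub>1 * m y)"
      by (simp only: y_def z_def u_def algebra_simps)
    then have "?x\<^sub>0 * ?x\<^sub>1 * (2 * m z) = ?x\<^sub>0 * ?x\<^sub>0 * m u + ?x\<^sub>1 * ?x\<^sub>1 * m y"
      by simp
    moreover have "exponents (m y) \<subseteq> veronese_exponents r d"
      using m by (simp add: in_veronese_iff)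
    ultimately obtain q where q: "exponents q \<subseteq> veronese_exponents r d" "?x\<^sub>0 * q = ?x\<^sub>1 * m y"
      using veronese_quotient[OF assms(1)] by blast
    have "y * q = monomial \<pi> 1 * ?x\<^sub>0 * (?x\<^sub>0 * q)"
      by (simp only: y_def mult.assoc)
    then have yq: "y * q = z * m y"
      by (simp only: q(2) z_def mult.assoc)
    have "q \<in> ?A"
      using q(1) by (simp add: in_veronese_iff)
    then have num: "m z + - (\<kappa> * q) \<in> ?A"
      using m by (intro S.add_mem S.uminus_mem S.mult_mem \<kappa>_mem) auto
    \<comment> \<open>The apparent pole of \<open>c\<close> along \<open>y = 0\<close> is absorbed:
      \<open>z/y\<close> times the numerator of \<open>D y\<close> is \<open>q\<close>, which lies
      in the ring, so the denominator remains \<open>s\<close>.\<close>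
    have "c * Fract (m y) s = Fract (\<kappa> * q) s"
      using nz y_nz yq by (simp add: c_def eq_fract algebra_simps)
    then have "s \<notin> Q \<and> S.pairing V \<phi> (?\<delta> z) Q - c * S.pairing V \<phi> (?\<delta> y) Q = Fract (m z + - (\<kappa> * q)) s"
      if "Q \<in> W" for Q
      using that eq nz by (simp add: eq_fract algebra_simps)
    then show "\<exists>W\<in>opens_in R V. P \<in> W \<and> (\<exists>m\<in>?A. \<exists>s\<in>?A. \<forall>Q\<in>W. s \<notin> Q \<and>
        S.pairing V \<phi> (?\<delta> z) Q - c * S.pairing V \<phi> (?\<delta> y) Q = Fract m s)"
      using W num s by blast
  qed
  show ?thesis
    unfolding has_cotorsion_def veronese_cone_differentials_def kaehler_sheaf_def
    unfolding R_def[symmetric] K_def[symmetric] M_def[symmetric]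
  proof
    assume surj: "sheaf_surjective R (associated_sheaf R M)
      (dual_sheaf R (dual_sheaf R (associated_sheaf R M))) (bidual_map R (associated_sheaf R M))"
    define U where "U = {P. primeideal P R}"
    have U: "U \<in> zariski_opens R"
    proof -
      have "\<not> ?A \<subseteq> P" if "primeideal P R" for P
        using S.prime_one[OF that] by auto
      then have "U = {P. primeideal P R \<and> \<not> ?A \<subseteq> P}"
        by (auto simp: U_def)
      then show ?thesis
        unfolding zariski_opens_def by auto
    qed
    have P: "vertex r d \<in> U"
      using primeideal_vertex by (simp add: U_def R_def)
    let ?\<tau> = "S.bidual_section (?\<delta> z) c (?\<delta> y) U"
    have "?\<tau> \<in> carrier (sections (dual_sheaf R (dual_sheaf R (associated_sheaf R M))) U)"
      by (rule S.bidual_section_in_bidual[OF \<delta> \<delta> reg])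
    then obtain V \<sigma> where V: "V \<in> opens_in R U" "vertex r d \<in> V" and \<sigma>: "\<sigma> \<in> carrier (S.\<M> V)"
      and lift: "bidual_map R (associated_sheaf R M) V \<sigma> = restrict ?\<tau> (opens_in R V)"
      using surj U P unfolding sheaf_surjective_def dual_sheaf_res by blast
    obtain w s where w: "w \<in> carrier M" and s: "s \<in> ?A - vertex r d"
      and val: "\<And>\<epsilon>. \<epsilon> \<in> linear_maps ?A M (self_module R) \<Longrightarrow>
        Fract (\<epsilon> w) s = Fract (\<epsilon> (?\<delta> z)) 1 - c * Fract (\<epsilon> (?\<delta> y)) 1"
      by (rule S.bidual_section_lift_value[OF V \<delta> \<delta> _ \<sigma> lift]) (erule (1) reg, rule that)
    \<comment> \<open>\<open>w\<close> is now the class of \<open>\<Sum> f a da\<close>, and a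
      derivation can be contracted with this finite sum.\<close>
    obtain f where f: "f \<in> carrier S.free" "w = S.relations K +>\<^bsub>S.free\<^esub> f"
      using w by (auto simp: M_def S.kaehler_carrier)
    have euler: "S.is_derivation K (euler i)" for i
      unfolding K_def by (rule is_derivation_euler)
    have quotient: "Fract (S.derivation_sum (euler i) f) s = Fract (euler i z) 1 - c * Fract (euler i y) 1" for i
      using val[OF S.kaehler_functional_linear[OF euler K, folded M_def], of i]
      by (simp add: f(2) S.kaehler_functional_coset[OF euler K f(1)]
          S.kaehler_functional_differential[OF euler K] mem)
    have s_nz: "s \<noteq> 0" and s0: "coefficient s 0 \<noteq> 0"
      using s by (auto simp: vertex_def)
    \<comment> \<open>By the choice of \<open>\<kappa>\<close>, contraction with
      \<open>euler 0\<close> kills the form.\<close>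
    have "c * Fract (euler 0 y) 1 = Fract (euler 0 z) 1"
      using y_nz \<kappa> by (simp add: c_def euler_y euler_z eq_fract algebra_simps)
    then have "S.derivation_sum (euler 0) f = 0"
      using quotient[of 0] s_nz by (simp add: Zero_fract_def eq_fract)
    \<comment> \<open>\<open>y\<close> does not involve \<open>x\<^sub>1\<close> and
      \<open>z\<close> contains it once, so contraction of the form with \<open>euler 1\<close> is
      \<open>z\<close> itself; clearing the denominator of the lift gives
      \<open>z * s\<close>.\<close>
    moreover have "S.derivation_sum (euler 1) f = z * s"
      using quotient[of 1] s_nz unfolding euler_y(2) euler_z(2)
      by (simp add: eq_fract Zero_fract_def[symmetric])
    moreover define T where "T = (\<Sum>a\<in>{a \<in> ?A. f a \<noteq> 0}. coefficient (f a) 0 * coefficient a \<alpha>)"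
    moreover have "coefficient (S.derivation_sum (euler i) f) \<alpha> = of_nat (exponent \<alpha> i) * T" for i
      unfolding T_def using f(1) assms \<alpha>_deg unfolding R_def
      by (intro coefficient_derivation_sum_euler) auto
    ultimately have "of_nat (exponent \<alpha> 0) * T = 0" "coefficient (z * s) \<alpha> = of_nat (exponent \<alpha> 1) * T"
      by (metis lookup_zero)+
    \<comment> \<open>As \<open>z\<close> is a single monomial with exponent
      \<open>\<alpha>\<close>, the coefficient of \<open>z * s\<close> there is the constant term of
      \<open>s\<close>.\<close>
    moreover have "coefficient (z * s) \<alpha> = coefficient s 0"
      using coefficient_monomial_mult[of \<alpha> 1 s 0] by (simp add: z_eq)
    ultimately show False
      using s0 assms by (simp add: \<alpha>_exp)
  qed
qed

end
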